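(* Let $p\ge1$ and let $(X,d,\mathfrak m)$ be a geodesic metric measure space, where $\mathfrak m$ is a doubling measure with optimal doubling constant $\beta\in(1,+\infty)$. Set $N=\frac{\log\beta}{\log2}$. Then the following statements are equivalent: (a) There exist positive constants $C_1$ and $C_2$ such that for every $u\in\mathrm{Lip}_b(X,d)$, $$C_1\int_X\frac{(\mathrm{lip}(u)(x))^{N+p}}{(\mathrm{Lip}(u)(x))^N}\,d\mathfrak m(x)\le\liminf_{\lambda\to+\infty}\lambda^p(\mathfrak m\times\mathfrak m)(E_{\lambda,u})\le\limsup_{\lambda\to+\infty}\lambda^p(\mathfrak m\times\mathfrak m)(E_{\lambda,u})\le C_2\int_X(\mathrm{Lip}(u)(x))^p\,d\mathfrak m(x),$$ where $$E_{\lambda,u}:=\Big\{(x,y)\in X\times X:\ x\ne y,\ |u(x)-u(y)|\ge\lambda\, d(x,y)^{\frac Np+1}\Big\}.$$ (b) There exist positive constants $a_1$ and $a_2$ such that $a_1\le\theta_N^-(x)\le\theta_N^+(x)\le a_2$ for $\mathfrak m$-a.e. $x\in X$.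
   Context: A metric measure space $(X,d,\mathfrak m)$ is a non-empty complete separable metric space $(X,d)$ with a Radon measure $\mathfrak m$ such that $0<\mathfrak m(U)<+\infty$ for every non-empty bounded open set $U\subset X$. $B_r(x):=\{y\in X: d(x,y)<r\}$. $\mathfrak m$ is a doubling measure if there is $\beta_0>1$ with $\mathfrak m(B_{2r}(x))\le\beta_0\,\mathfrak m(B_r(x))$ for all $x\in X$, $r>0$; the optimal doubling constant is $\beta:=\sup_{x\in X,\,r>0}\frac{\mathfrak m(B_{2r}(x))}{\mathfrak m(B_r(x))}$, taken to lie in $(1,+\infty)$. $N=\log\beta/\log2$ is called the doubling dimension. For $u:X\to\mathbb R$: $\mathrm{Lip}(u)(x):=\limsup_{r\to0^+}\sup_{y\in B_r(x)}\frac{|u(y)-u(x)|}{r}$ and $\mathrm{lip}(u)(x):=\liminf_{r\to0^+}\sup_{y\in B_r(x)}\frac{|u(y)-u(x)|}{r}$. $\mathrm{Lip}_b(X,d)$ is the set of (globally) Lipschitz functions $u:X\to\mathbb R$ with bounded support. Densities: $\theta_N^+(x):=\limsup_{r\to0^+}\frac{\mathfrak m(B_r(x))}{r^N}$, $\theta_N^-(x):=\liminf_{r\to0^+}\frac{\mathfrak m(B_r(x))}{r^N}$. Convention: $0\cdot\infty=0$; in particular the quotient $\mathrm{lip}(u)^{N+p}/\mathrm{Lip}(u)^N$ is $0$ wherever $\mathrm{Lip}(u)=0$. *)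

theory Defs
  imports "HOL-Analysis.Analysis"
begin

text \<open>The complete separable metric space is the universe of a type of class
  \<^class>\<open>polish_space\<close>, with its metric \<^const>\<open>dist\<close>; types are non-empty.\<close>

definition radon_measure :: "'a::polish_space measure \<Rightarrow> bool" where
  "radon_measure M \<longleftrightarrow>
     sets M = sets borel \<and>
     (\<forall>x. \<exists>U. open U \<and> x \<in> U \<and> emeasure M U < \<infinity>) \<and>
     (\<forall>A\<in>sets borel. emeasure M A = (SUP K\<in>{K. compact K \<and> K \<subseteq> A}. emeasure M K))"

definition metric_measure_space :: "'a::polish_space measure \<Rightarrow> bool" where
  "metric_measure_space M \<longleftrightarrow>
     radon_measure M \<and>
     (\<forall>U. open U \<longrightarrow> bounded U \<longrightarrow> U \<noteq> {} \<longrightarrow> 0 < emeasure M U \<and> emeasure M U < \<infinity>)"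

definition geodesic_space :: "'a::metric_space itself \<Rightarrow> bool" where
  "geodesic_space _ \<longleftrightarrow>
     (\<forall>x y :: 'a. \<exists>\<gamma> :: real \<Rightarrow> 'a. \<gamma> 0 = x \<and> \<gamma> 1 = y \<and>
        (\<forall>s\<in>{0..1}. \<forall>t\<in>{0..1}. dist (\<gamma> s) (\<gamma> t) = \<bar>s - t\<bar> * dist x y))"

definition doubling_measure :: "'a::metric_space measure \<Rightarrow> bool" where
  "doubling_measure M \<longleftrightarrow>
     (\<exists>\<beta>0::real. \<beta>0 > 1 \<and>
        (\<forall>x. \<forall>r>0. emeasure M (ball x (2 * r)) \<le> ennreal \<beta>0 * emeasure M (ball x r)))"

definition optimal_doubling_constant :: "'a::metric_space measure \<Rightarrow> ennreal" where
  "optimal_doubling_constant M =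
     (SUP x. SUP r\<in>{0<..}. emeasure M (ball x (2 * r)) / emeasure M (ball x r))"

definition Lip_slope :: "('a::metric_space \<Rightarrow> real) \<Rightarrow> 'a \<Rightarrow> ennreal" where
  "Lip_slope u x = Limsup (at_right 0) (\<lambda>r. SUP y\<in>ball x r. ennreal (\<bar>u y - u x\<bar> / r))"

definition lip_slope :: "('a::metric_space \<Rightarrow> real) \<Rightarrow> 'a \<Rightarrow> ennreal" where
  "lip_slope u x = Liminf (at_right 0) (\<lambda>r. SUP y\<in>ball x r. ennreal (\<bar>u y - u x\<bar> / r))"

definition Lip_b :: "('a::metric_space \<Rightarrow> real) set" where
  "Lip_b = {u. (\<exists>L. L-lipschitz_on UNIV u) \<and> bounded (closure {x. u x \<noteq> 0})}"

text \<open>Both slopes of a Lipschitz function are finite, so \<^const>\<open>enn2real\<close> loses nothing on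
  \<^term>\<open>Lip_b\<close>. Where \<^term>\<open>Lip_slope u x = 0\<close>, the quotient is \<open>0\<close> because \<open>0 powr N = 0\<close> and
  division by \<open>0\<close> in \<^typ>\<open>real\<close> yields \<open>0\<close>.\<close>

definition lip_energy :: "'a::metric_space measure \<Rightarrow> real \<Rightarrow> real \<Rightarrow> ('a \<Rightarrow> real) \<Rightarrow> ennreal" where
  "lip_energy M N p u =
     (\<integral>\<^sup>+x. ennreal (enn2real (lip_slope u x) powr (N + p) / enn2real (Lip_slope u x) powr N) \<partial>M)"

definition Lip_energy :: "'a::metric_space measure \<Rightarrow> real \<Rightarrow> ('a \<Rightarrow> real) \<Rightarrow> ennreal" where
  "Lip_energy M p u = (\<integral>\<^sup>+x. ennreal (enn2real (Lip_slope u x) powr p) \<partial>M)"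

definition E_set :: "real \<Rightarrow> real \<Rightarrow> real \<Rightarrow> ('a::metric_space \<Rightarrow> real) \<Rightarrow> ('a \<times> 'a) set" where
  "E_set N p l u = {(x, y). x \<noteq> y \<and> \<bar>u x - u y\<bar> \<ge> l * dist x y powr (N / p + 1)}"

definition upper_density :: "'a::metric_space measure \<Rightarrow> real \<Rightarrow> 'a \<Rightarrow> ennreal" where
  "upper_density M N x = Limsup (at_right 0) (\<lambda>r. emeasure M (ball x r) / ennreal (r powr N))"

definition lower_density :: "'a::metric_space measure \<Rightarrow> real \<Rightarrow> 'a \<Rightarrow> ennreal" where
  "lower_density M N x = Liminf (at_right 0) (\<lambda>r. emeasure M (ball x r) / ennreal (r powr N))"

end

(*
  Put E_r(x) = {y. x ~= y and |u x - u y| >= d(x,y) (d(x,y)/r)^(N/p)}; with l = r^(-N/p) the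
  functional l^p (m x m)(E_l) becomes r^(-N) times the integral of m(E_r(x)), and l -> oo becomes
  r -> 0.  Doubling with optimal constant 2^N makes m(B_r(x))/r^N almost nonincreasing in r, so a
  density bound at x is a growth bound for m(B_R(x)) at all scales R.

  (a) ==> (b): test with u = max 0 (e - d(.,S)), S finite; slopes lie in [1/2, 1] where
  0 < d(.,S) < e.  For S = {x0} a slice contains a ball of radius comparable to r around a point of
  the geodesic to x0, which bounds m(B_R(x0)) by a multiple of R^N.  For S an e-net of a compact K
  on which m(B_R(x)) <= c R^N for all R, the lower energy bound forces m(K) = 0 when c is small.

  (b) ==> (a): the upper bound is the reverse Fatou lemma.  For the lower bound the local Lipschitz
  constant has to be transferred from x to nearby points y where u varies.  On a compact K where
  the slopes are uniformly controlled this works unless a ball around y of comparable radius misses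
  K; the measure of that event is controlled, by Fubini's theorem, by m(K_2R - K), which tends to 0.
  No differentiation theorem or covering argument is needed.
*)

theory Submission
  imports Defs
begin

text \<open>The quotient lip^(N+p) / Lip^N is a volume count. Write a and b for lip(u)(x) and
  Lip(u)(x). At scale r the slice condition is tested at distance about R = a^(p/N) r. Some y in
  B_R(x) has |u y - u x| of order a R, and if u has slope at most b near y, this variation persists
  on a ball around y of radius about (a/b) R. The volume of that ball divided by r^N is of order a^p
  (a/b)^N. The upper bound has the same origin: the slice lies in a ball of radius about b^(p/N) r,
  whose volume is of order b^p r^N. The obstacle is that slopes at x give no estimate for pairs of
  points both different from x. Uniform estimates exist only on pieces of X, so the lower bound is
  shown for every measurable part of a piece, by inner regularity, and then glued over countably
  many pieces. For the lower density, the net decouples energy from length scale: however small e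
  is, \<open>bump S e\<close> has slope of order 1 on almost all of K, yet vanishes away from a thin
  neighbourhood of K.\<close>

section \<open>Points on geodesics and one-sided limits along sequences\<close>

lemma geodesic_point:
  fixes x y :: "'a::metric_space"
  assumes "geodesic_space TYPE('a)" "0 \<le> t" "t \<le> dist x y"
  obtains z where "dist x z = t" "dist z y = dist x y - t"
proof (cases "x = y")
  case True
  then show ?thesis using assms that[of x] by simp
next
  case False
  obtain \<gamma> :: "real \<Rightarrow> 'a" where \<gamma>: "\<gamma> 0 = x" "\<gamma> 1 = y"
    "\<And>s t. s \<in> {0..1} \<Longrightarrow> t \<in> {0..1} \<Longrightarrow> dist (\<gamma> s) (\<gamma> t) = \<bar>s - t\<bar> * dist x y"
    using assms(1) unfolding geodesic_space_def by metis
  define s where "s = t / dist x y"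
  have s: "0 \<le> s" "s \<le> 1" "s * dist x y = t"
    using assms False by (auto simp: s_def divide_simps)
  have "dist x (\<gamma> s) = t" "dist (\<gamma> s) y = dist x y - t"
    using \<gamma>(3)[of 0 s] \<gamma>(3)[of s 1] s \<gamma>(1,2) by (auto simp: algebra_simps)
  then show ?thesis by (rule that)
qed

text \<open>Fatou's lemma for the counting measure on \<open>bool\<close>, whose two points carry
  the two sequences.\<close>

lemma liminf_superadditive_ennreal:
  fixes f g :: "nat \<Rightarrow> ennreal"
  shows "liminf f + liminf g \<le> liminf (\<lambda>n. f n + g n)"
proof -
  have "(\<integral>\<^sup>+b. liminf (\<lambda>n. if b then f n else g n) \<partial>count_space UNIV)
      \<le> liminf (\<lambda>n. \<integral>\<^sup>+b. (if b then f n else g n) \<partial>count_space UNIV)"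
    by (rule nn_integral_liminf) auto
  then show ?thesis
    by (simp add: nn_integral_count_space_finite UNIV_bool add.commute)
qed

text \<open>Fatou's lemma speaks of sequences, so the limit r -> 0+ is replaced by all null
  sequences. If the bound fails, some c' < c is not exceeded at points arbitrarily close to 0, and
  these form a bad sequence.\<close>

lemma Liminf_at_right_0_sequentially_ge:
  fixes f :: "real \<Rightarrow> ennreal"
  assumes "\<And>X. (\<And>n. X n > 0) \<Longrightarrow> X \<longlonglongrightarrow> 0 \<Longrightarrow> c \<le> liminf (\<lambda>n. f (X n))"
  shows "c \<le> Liminf (at_right 0) f"
proof (rule ccontr)
  assume "\<not> c \<le> Liminf (at_right 0) f"
  then obtain c' where c': "c' < c" "\<not> eventually (\<lambda>r. c' < f r) (at_right 0)"
    unfolding le_Liminf_iff by auto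
  have "\<exists>r. 0 < r \<and> r < 1 / real (Suc n) \<and> f r \<le> c'" for n
  proof (rule ccontr)
    assume "\<not> ?thesis"
    then have "\<And>r. 0 < r \<Longrightarrow> r < 1 / real (Suc n) \<Longrightarrow> c' < f r" by force
    then have "eventually (\<lambda>r. c' < f r) (at_right 0)"
      unfolding eventually_at_right_field by (intro exI[of _ "1 / real (Suc n)"]) auto
    with c' show False by simp
  qed
  then obtain X where X: "\<And>n. 0 < X n" "\<And>n. X n < 1 / real (Suc n)" "\<And>n. f (X n) \<le> c'"
    by metis
  have "X \<longlonglongrightarrow> 0"
  proof (rule tendsto_sandwich[OF _ _ tendsto_const LIMSEQ_inverse_real_of_nat])
    show "\<forall>\<^sub>F n in sequentially. 0 \<le> X n" using X(1) by (simp add: less_imp_le)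
    show "\<forall>\<^sub>F n in sequentially. X n \<le> inverse (real (Suc n))"
      by (intro always_eventually allI) (simp only: inverse_eq_divide less_imp_le[OF X(2)])
  qed
  from assms[OF X(1) this] have "c \<le> liminf (\<lambda>n. f (X n))" .
  also have "\<dots> \<le> c'" by (rule Liminf_le) (auto simp: X(3))
  finally show False using c' by simp
qed

text \<open>The threshold \<open>\<delta>\<close> lets a user assume that every term of the sequence
  is small, which provides one majorant for all terms in the reverse Fatou lemma.\<close>

lemma Limsup_at_right_0_sequentially_le:
  fixes f :: "real \<Rightarrow> ennreal"
  assumes "0 < \<delta>"
    and le: "\<And>X. (\<And>n. X n > 0) \<Longrightarrow> (\<And>n. X n < \<delta>) \<Longrightarrow> X \<longlonglongrightarrow> 0 \<Longrightarrow> limsup (\<lambda>n. f (X n)) \<le> c"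
  shows "Limsup (at_right 0) f \<le> c"
proof (rule ccontr)
  assume "\<not> Limsup (at_right 0) f \<le> c"
  then obtain c' where c': "c < c'" "\<not> eventually (\<lambda>r. f r < c') (at_right 0)"
    unfolding Limsup_le_iff by auto
  have "\<exists>r. 0 < r \<and> r < \<delta> \<and> r < 1 / real (Suc n) \<and> c' \<le> f r" for n
  proof (rule ccontr)
    assume "\<not> ?thesis"
    then have "\<And>r. 0 < r \<Longrightarrow> r < \<delta> \<Longrightarrow> r < 1 / real (Suc n) \<Longrightarrow> f r < c'" by force
    then have "eventually (\<lambda>r. f r < c') (at_right 0)"
      unfolding eventually_at_right_field by (intro exI[of _ "min \<delta> (1 / real (Suc n))"]) (auto simp: \<open>0 < \<delta>\<close>)
    with c' show False by simp
  qed
  then obtain X where X: "\<And>n. 0 < X n" "\<And>n. X n < \<delta>" "\<And>n. X n < 1 / real (Suc n)" "\<And>n. c' \<le> f (X n)"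
    by metis
  have "X \<longlonglongrightarrow> 0"
  proof (rule tendsto_sandwich[OF _ _ tendsto_const LIMSEQ_inverse_real_of_nat])
    show "\<forall>\<^sub>F n in sequentially. 0 \<le> X n" using X(1) by (simp add: less_imp_le)
    show "\<forall>\<^sub>F n in sequentially. X n \<le> inverse (real (Suc n))"
      by (intro always_eventually allI) (simp only: inverse_eq_divide less_imp_le[OF X(3)])
  qed
  have "c' \<le> limsup (\<lambda>n. f (X n))" by (rule le_Limsup) (auto simp: X(4))
  also have "\<dots> \<le> c" by (rule le[OF X(1,2) \<open>X \<longlonglongrightarrow> 0\<close>])
  finally show False using c' by simp
qed

lemma Liminf_filtermap_complete_linorder:
  fixes g :: "_ \<Rightarrow> _ :: complete_linorder"
  shows "Liminf (filtermap f F) g = Liminf F (\<lambda>x. g (f x))"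
proof (rule antisym[OF Liminf_filtermap_le])
  show "Liminf F (\<lambda>x. g (f x)) \<le> Liminf (filtermap f F) g"
    unfolding le_Liminf_iff eventually_filtermap by (auto intro: less_LiminfD)
qed

lemma Limsup_filtermap_complete_linorder:
  fixes g :: "_ \<Rightarrow> _ :: complete_linorder"
  shows "Limsup (filtermap f F) g = Limsup F (\<lambda>x. g (f x))"
proof (rule antisym[OF _ Limsup_filtermap_ge])
  show "Limsup (filtermap f F) g \<le> Limsup F (\<lambda>x. g (f x))"
    unfolding Limsup_le_iff eventually_filtermap by (auto intro: Limsup_lessD)
qed

section \<open>Balls and slices in a doubling space\<close>

text \<open>Doubling is stated for the real-valued \<open>measure\<close>, so that volume estimates
  are real arithmetic; balls have finite measure, and \<open>emeasure_ball\<close> translates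
  back.\<close>

locale doubling_mms =
  fixes M :: "'a::polish_space measure" and \<beta> N p :: real
  assumes mms: "metric_measure_space M" and p_ge_1: "1 \<le> p"
    and doubling: "\<And>x r. 0 < r \<Longrightarrow> measure M (ball x (2 * r)) \<le> \<beta> * measure M (ball x r)"
    and beta_gt_1: "1 < \<beta>" and N_eq: "N = ln \<beta> / ln 2"
begin

lemma beta_eq: "\<beta> = 2 powr N"
  using beta_gt_1 by (simp add: N_eq powr_def)

lemma N_pos: "0 < N" using beta_gt_1 by (simp add: N_eq)
lemma p_pos: "0 < p" using p_ge_1 by simp

lemma sets_M [measurable_cong, simp]: "sets M = sets borel"
  using mms by (simp add: metric_measure_space_def radon_measure_def)

lemma space_M [simp]: "space M = UNIV"
  using sets_eq_imp_space_eq[OF sets_M] by simp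

lemma emeasure_ball_less_top: "emeasure M (ball x r) < \<infinity>"
proof (cases "0 < r")
  case True
  then show ?thesis
    using mms by (simp add: metric_measure_space_def)
qed (simp add: not_less ball_empty)

lemma emeasure_bounded_finite: "bounded A \<Longrightarrow> emeasure M A < \<infinity>"
proof -
  assume "bounded A"
  then obtain x r where "A \<subseteq> ball x r"
    using bounded_subset_ballD by blast
  then have "emeasure M A \<le> emeasure M (ball x r)"
    by (intro emeasure_mono) auto
  then show ?thesis using emeasure_ball_less_top[of x r] by (rule le_less_trans)
qed

lemma emeasure_bounded: "bounded A \<Longrightarrow> emeasure M A = ennreal (measure M A)"
  using emeasure_bounded_finite[of A] by (simp add: emeasure_eq_ennreal_measure top.not_eq_extremum)

abbreviation V :: "'a \<Rightarrow> real \<Rightarrow> real" where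
  "V x r \<equiv> measure M (ball x r)"

lemma emeasure_ball: "emeasure M (ball x r) = ennreal (V x r)"
  by (rule emeasure_bounded) simp

lemma V_pos: "0 < r \<Longrightarrow> 0 < V x r"
proof -
  assume "0 < r"
  then have "0 < emeasure M (ball x r)"
    using mms by (simp add: metric_measure_space_def)
  then show ?thesis by (simp add: emeasure_ball)
qed

lemma measure_mono_bounded:
  "A \<subseteq> B \<Longrightarrow> bounded B \<Longrightarrow> B \<in> sets borel \<Longrightarrow> measure M A \<le> measure M B"
proof -
  assume a: "A \<subseteq> B" "bounded B" "B \<in> sets borel"
  then have "emeasure M A \<le> emeasure M B" by (intro emeasure_mono) auto
  moreover have "bounded A" using a bounded_subset by blast
  ultimately show ?thesis using a(2) by (simp add: emeasure_bounded)
qed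

lemma V_mono: "dist x y + r \<le> s \<Longrightarrow> V x r \<le> V y s"
proof (rule measure_mono_bounded)
  assume a: "dist x y + r \<le> s"
  show "ball x r \<subseteq> ball y s"
  proof
    fix z assume "z \<in> ball x r"
    then show "z \<in> ball y s" using a dist_triangle[of y z x] by (simp add: dist_commute)
  qed
qed auto

lemma sigma_finite: "sigma_finite_measure M"
proof
  define A where "A = range (\<lambda>n::nat. ball (undefined::'a) (real n))"
  have "countable A" unfolding A_def by auto
  moreover have "A \<subseteq> sets M" by (auto simp: A_def)
  moreover have "\<Union>A = space M"
  proof -
    have "\<exists>n::nat. x \<in> ball undefined (real n)" for x :: 'a
      using reals_Archimedean2[of "dist undefined x"] by auto
    then show ?thesis by (auto simp: A_def)
  qed
  moreover have "\<forall>a\<in>A. emeasure M a \<noteq> \<infinity>"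
    by (auto simp: A_def emeasure_ball)
  ultimately show "\<exists>A. countable A \<and> A \<subseteq> sets M \<and> \<Union> A = space M \<and> (\<forall>a\<in>A. emeasure M a \<noteq> \<infinity>)"
    by blast
qed

end

sublocale doubling_mms \<subseteq> pair_sigma_finite M M
  by (simp add: pair_sigma_finite_def sigma_finite)

context doubling_mms
begin

lemma sets_pair: "sets (M \<Otimes>\<^sub>M M) = sets borel"
  by (simp add: borel_prod[symmetric] cong: sets_pair_measure_cong)

text \<open>Balls are the sections of the open set of pairs at distance below r, and in a second
  countable space open sets of pairs belong to the product sigma-algebra.\<close>

lemma V_measurable [measurable]: "(\<lambda>x. V x r) \<in> borel_measurable borel"
proof -
  have "{xy :: 'a \<times> 'a. dist (fst xy) (snd xy) < r} \<in> sets (M \<Otimes>\<^sub>M M)"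
    unfolding sets_pair by (intro borel_open open_Collect_less continuous_intros)
  note meas = M1.measurable_emeasure_Pair[OF this]
  have eq: "Pair x -` {xy :: 'a \<times> 'a. dist (fst xy) (snd xy) < r} = ball x r" for x
    by auto
  have "(\<lambda>x. enn2real (emeasure M (ball x r))) \<in> borel_measurable M"
    using borel_measurable_enn2real[OF meas] unfolding eq .
  then show ?thesis by (simp add: measure_def cong: measurable_cong_sets)
qed

lemma V_pow2: "0 < r \<Longrightarrow> V x (2 ^ n * r) \<le> \<beta> ^ n * V x r"
proof (induction n)
  case (Suc n)
  have "V x (2 ^ Suc n * r) \<le> \<beta> * V x (2 ^ n * r)"
    using doubling[of "2 ^ n * r" x] Suc.prems by (simp add: mult.assoc)
  also have "\<dots> \<le> \<beta> * (\<beta> ^ n * V x r)"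
    using Suc beta_gt_1 by (intro mult_left_mono) auto
  finally show ?case by (simp add: mult_ac)
qed simp

text \<open>Take the least n with R \<le> 2^n r, so that 2^n r \<le> 2 R. Doubling n times costs
  \<open>\<beta> ^ n = (2 ^ n) powr N\<close>, and rounding up to 2 R costs one further
  \<open>\<beta>\<close>. This is the near-monotonicity of V x r / r^N, multiplied out.\<close>

lemma V_ratio:
  assumes "0 < r" "r \<le> R"
  shows "V x R * r powr N \<le> \<beta> * V x r * R powr N"
proof -
  obtain n where n: "R \<le> 2 ^ n * r" "2 ^ n * r \<le> 2 * R"
  proof -
    obtain m :: nat where m: "R / r < 2 ^ m"
      using real_arch_pow[of 2 "R / r"] by auto
    define n where "n = (LEAST n::nat. R \<le> 2 ^ n * r)"
    have ex: "R \<le> 2 ^ m * r" using m assms by (simp add: divide_simps)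
    then have 1: "R \<le> 2 ^ n * r" unfolding n_def by (rule LeastI)
    have "2 ^ n * r \<le> 2 * R"
    proof (cases n)
      case (Suc k)
      then have "\<not> R \<le> 2 ^ k * r" using not_less_Least[of k "\<lambda>n. R \<le> 2 ^ n * r"]
        by (simp add: n_def)
      then show ?thesis using Suc by simp
    qed (use assms in simp)
    with 1 show ?thesis by (rule that)
  qed
  have b: "\<beta> ^ n = (2 ^ n) powr N"
    by (simp add: beta_eq powr_powr powr_realpow[symmetric] mult.commute)
  have "\<beta> ^ n * r powr N = (2 ^ n * r) powr N"
    using assms by (simp add: b powr_mult)
  also have "\<dots> \<le> (2 * R) powr N"
    using n assms N_pos by (intro powr_mono2) auto
  also have "\<dots> = \<beta> * R powr N" using assms by (simp add: beta_eq powr_mult)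
  finally have 2: "\<beta> ^ n * r powr N \<le> \<beta> * R powr N" .
  have "V x R \<le> V x (2 ^ n * r)" by (rule V_mono) (use n in simp)
  also have "\<dots> \<le> \<beta> ^ n * V x r" by (rule V_pow2) fact
  finally have "V x R * r powr N \<le> \<beta> ^ n * V x r * r powr N"
    by (intro mult_right_mono) auto
  also have "\<dots> = V x r * (\<beta> ^ n * r powr N)" by simp
  also have "\<dots> \<le> V x r * (\<beta> * R powr N)"
    using 2 by (intro mult_left_mono) auto
  finally show ?thesis by (simp add: mult_ac)
qed

lemma powr_exp_cancel: "0 \<le> r \<Longrightarrow> (r powr (p / N)) powr (N / p) = r"
    "0 \<le> r \<Longrightarrow> (r powr (p / N)) powr N = r powr p"
    "0 \<le> r \<Longrightarrow> (r powr (N / p)) powr (p / N) = r"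
  using N_pos p_pos by (simp_all add: powr_powr)

section \<open>Slices and the rescaled functional\<close>

text \<open>The factor \<open>dist x y\<close> is kept apart so that the condition compares the
  difference quotient of u with (d/r)^(N/p), which makes r a length scale.\<close>

definition slice :: "('a \<Rightarrow> real) \<Rightarrow> real \<Rightarrow> 'a \<Rightarrow> 'a set" where
  "slice u r x = {y. x \<noteq> y \<and> dist x y * (dist x y / r) powr (N / p) \<le> \<bar>u x - u y\<bar>}"

definition Q :: "('a \<Rightarrow> real) \<Rightarrow> real \<Rightarrow> ennreal" where
  "Q u r = ennreal (r powr - N) * (\<integral>\<^sup>+x. emeasure M (slice u r x) \<partial>M)"

lemma slice_pair:
  assumes "0 < r"
  shows "slice u r x = Pair x -` E_set N p (r powr (-(N/p))) u"
proof -
  have "dist x y * (dist x y / r) powr (N / p) = r powr (-(N / p)) * dist x y powr (N / p + 1)" 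
    if "x \<noteq> y" for y
  proof -
    have "dist x y powr (N / p + 1) = dist x y powr (N / p) * dist x y"
      using that by (simp add: powr_add)
    then show ?thesis
      using assms by (simp only: powr_divide powr_minus) (simp add: divide_inverse mult_ac powr_divide powr_minus)
  qed
  then show ?thesis unfolding slice_def E_set_def by auto
qed

lemma E_set_sets: "continuous_on UNIV u \<Longrightarrow> E_set N p l u \<in> sets (M \<Otimes>\<^sub>M M)"
proof -
  assume u: "continuous_on UNIV u"
  have u: "u \<in> borel_measurable borel"
    using u by (rule borel_measurable_continuous_onI)
  have "E_set N p l u = {xy. fst xy \<noteq> snd xy} \<inter> {xy \<in> space (borel \<Otimes>\<^sub>M borel). l * dist (fst xy) (snd xy) powr (N / p + 1) \<le> \<bar>u (fst xy) - u (snd xy)\<bar>}"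
    by (auto simp: E_set_def space_pair_measure)
  moreover have "{xy :: 'a \<times> 'a. fst xy \<noteq> snd xy} \<in> sets (borel \<Otimes>\<^sub>M borel)"
    unfolding borel_prod by (intro borel_open open_Collect_neq continuous_intros)
  moreover have "{xy \<in> space (borel \<Otimes>\<^sub>M borel). l * dist (fst xy) (snd xy) powr (N / p + 1) \<le> \<bar>u (fst xy) - u (snd xy)\<bar>} \<in> sets (borel \<Otimes>\<^sub>M borel)"
  proof (rule borel_measurable_le)
    have u': "(\<lambda>xy. u (fst xy)) \<in> borel_measurable (borel \<Otimes>\<^sub>M borel)" "(\<lambda>xy. u (snd xy)) \<in> borel_measurable (borel \<Otimes>\<^sub>M borel)"
      using measurable_compose[OF measurable_fst] measurable_compose[OF measurable_snd] u by blast+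
    then show "(\<lambda>xy. \<bar>u (fst xy) - u (snd xy)\<bar>) \<in> borel_measurable (borel \<Otimes>\<^sub>M borel)"
      by (intro borel_measurable_abs borel_measurable_diff)
    have "(\<lambda>xy :: 'a \<times> 'a. dist (fst xy) (snd xy)) \<in> borel_measurable (borel \<Otimes>\<^sub>M borel)"
      by (intro borel_measurable_dist measurable_fst measurable_snd)
    then show "(\<lambda>xy :: 'a \<times> 'a. l * dist (fst xy) (snd xy) powr (N / p + 1)) \<in> borel_measurable (borel \<Otimes>\<^sub>M borel)"
      by (intro borel_measurable_times borel_measurable_const powr_real_measurable)
  qed
  ultimately show ?thesis unfolding sets_pair borel_prod by (simp only: sets.Int)
qed

lemma slice_sets [measurable]: "0 < r \<Longrightarrow> continuous_on UNIV u \<Longrightarrow> slice u r x \<in> sets borel"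
  using sets_Pair1[OF E_set_sets] by (simp add: slice_pair)

lemma slice_measurable:
  "0 < r \<Longrightarrow> continuous_on UNIV u \<Longrightarrow> (\<lambda>x. emeasure M (slice u r x)) \<in> borel_measurable borel"
  using M1.measurable_emeasure_Pair[OF E_set_sets] by (simp add: slice_pair)

lemma Q_eq:
  assumes "0 < r" "continuous_on UNIV u"
  shows "ennreal ((r powr (-(N/p))) powr p) * emeasure (M \<Otimes>\<^sub>M M) (E_set N p (r powr (-(N/p))) u) = Q u r"
  using assms M1.emeasure_pair_measure_alt[OF E_set_sets] p_pos
  by (simp add: Q_def slice_pair powr_powr)

text \<open>An equality of filters, not merely a limit, so that Liminf and Limsup are both preserved
  by the substitution; the inverse is l -> l^(-p/N).\<close>

lemma filtermap_scale: "filtermap (\<lambda>r. r powr (-(N/p))) (at_right 0) = at_top"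
proof (rule filtermap_fun_inverse[where g = "\<lambda>l. l powr (-(p/N))"])
  have e: "-(p/N) < 0" "0 < N/p" using N_pos p_pos by auto
  show "filterlim (\<lambda>l. l powr (-(p/N))) (at_right 0) at_top"
  proof (rule tendsto_imp_filterlim_at_right)
    show "((\<lambda>l. l powr (-(p/N))) \<longlongrightarrow> 0) at_top"
      by (rule tendsto_neg_powr[OF e(1)]) (rule filterlim_ident)
    show "\<forall>\<^sub>F l in at_top. 0 < l powr (-(p/N))"
      using eventually_gt_at_top[of "0::real"] by eventually_elim simp
  qed
  have "filterlim (\<lambda>r::real. r powr (N/p)) (at_right 0) (at_right 0)"
  proof (rule tendsto_imp_filterlim_at_right)
    show "((\<lambda>r::real. r powr (N/p)) \<longlongrightarrow> 0) (at_right 0)"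
    proof (rule tendsto_zero_powrI)
      show "((\<lambda>r::real. r) \<longlongrightarrow> 0) (at_right 0)" by (rule tendsto_ident_at)
      show "\<forall>\<^sub>F r::real in at_right 0. 0 \<le> r"
        using eventually_at_right_less[of "0::real"] by eventually_elim simp
      show "((\<lambda>r::real. N / p) \<longlongrightarrow> N / p) (at_right 0)" by (rule tendsto_const)
    qed (use e in auto)
    show "\<forall>\<^sub>F r::real in at_right 0. 0 < r powr (N/p)"
      using eventually_at_right_less[of "0::real"] by eventually_elim simp
  qed
  from filterlim_compose[OF filterlim_inverse_at_top_right this]
  show "LIM r at_right 0. r powr - (N / p) :> at_top"
    by (simp add: powr_minus)
  show "\<forall>\<^sub>F l in at_top. (l powr - (p / N)) powr - (N / p) = l"
    using eventually_gt_at_top[of "0::real"]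
  proof eventually_elim
    case (elim l)
    then show ?case using N_pos p_pos by (simp add: powr_powr)
  qed
qed

lemma
  assumes "continuous_on UNIV u"
  shows Liminf_Q: "Liminf at_top (\<lambda>l::real. ennreal (l powr p) * emeasure (M \<Otimes>\<^sub>M M) (E_set N p l u)) = Liminf (at_right 0) (Q u)" (is "Liminf at_top ?f = _")
   and Limsup_Q: "Limsup at_top (\<lambda>l::real. ennreal (l powr p) * emeasure (M \<Otimes>\<^sub>M M) (E_set N p l u)) = Limsup (at_right 0) (Q u)"
proof -
  let ?g = "\<lambda>r. r powr (-(N/p))"
  have ev: "\<forall>\<^sub>F r in at_right 0. ?f (?g r) = Q u r"
    using eventually_at_right_less[of "0::real"] by eventually_elim (rule Q_eq[OF _ assms])
  have "Liminf at_top ?f = Liminf (at_right 0) (\<lambda>r. ?f (?g r))"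
    unfolding filtermap_scale[symmetric] by (rule Liminf_filtermap_complete_linorder)
  also have "\<dots> = Liminf (at_right 0) (Q u)"
    by (rule Liminf_eq[OF ev])
  finally show "Liminf at_top ?f = Liminf (at_right 0) (Q u)" .
  have "Limsup at_top ?f = Limsup (at_right 0) (\<lambda>r. ?f (?g r))"
    unfolding filtermap_scale[symmetric] by (rule Limsup_filtermap_complete_linorder)
  also have "\<dots> = Limsup (at_right 0) (Q u)"
    by (rule Limsup_eq[OF ev])
  finally show "Limsup at_top ?f = Limsup (at_right 0) (Q u)" .
qed

end

section \<open>Distance test functions and density bounds\<close>

lemma Lip_slope_le_lipschitz:
  assumes "L-lipschitz_on UNIV u"
  shows "Lip_slope u x \<le> ennreal L"
  unfolding Lip_slope_def
proof (rule Limsup_bounded)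
  have L: "0 \<le> L" "\<And>y. \<bar>u y - u x\<bar> \<le> L * dist y x"
    using assms by (auto simp: lipschitz_on_def dist_real_def)
  show "\<forall>\<^sub>F r in at_right 0. (SUP y\<in>ball x r. ennreal (\<bar>u y - u x\<bar> / r)) \<le> ennreal L"
    using eventually_at_right_less[of "0::real"]
  proof eventually_elim
    case (elim r)
    show ?case
    proof (rule SUP_least)
      fix y assume "y \<in> ball x r"
      then have "\<bar>u y - u x\<bar> \<le> L * r"
        using L(2)[of y] mult_left_mono[OF _ L(1), of "dist y x" r] by (simp add: dist_commute)
      then show "ennreal (\<bar>u y - u x\<bar> / r) \<le> ennreal L"
        using elim by (intro ennreal_leI) (simp add: divide_simps)
    qed
  qed
qed

lemma lip_slope_le_Lip_slope: "lip_slope u x \<le> Lip_slope u x"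
  unfolding lip_slope_def Lip_slope_def by (rule Liminf_le_Limsup) simp

definition bump :: "'a::metric_space set \<Rightarrow> real \<Rightarrow> 'a \<Rightarrow> real" where
  "bump S e x = max 0 (e - infdist x S)"

lemma bump_lipschitz: "1-lipschitz_on UNIV (bump S e)"
proof (rule lipschitz_onI)
  fix x y
  show "dist (bump S e x) (bump S e y) \<le> 1 * dist x y"
    using infdist_triangle_abs[of x S y] by (auto simp: bump_def dist_real_def)
qed simp

lemma bump_diff_le: "\<bar>bump S e x - bump S e y\<bar> \<le> dist x y"
  using bump_lipschitz[of S e] by (auto simp: lipschitz_on_def dist_real_def)

lemma continuous_on_bump: "continuous_on UNIV (bump S e)"
  using bump_lipschitz by (rule lipschitz_on_continuous_on)

lemma finite_infdist_attained:
  assumes "finite S" "S \<noteq> {}"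
  obtains s where "s \<in> S" "infdist x S = dist x s"
proof -
  have "infdist x S = Min ((\<lambda>s. dist x s) ` S)"
    using assms by (simp add: infdist_notempty cInf_eq_Min)
  moreover have "Min ((\<lambda>s. dist x s) ` S) \<in> (\<lambda>s. dist x s) ` S"
    using assms by (intro Min_in) auto
  ultimately show ?thesis using that by auto
qed

lemma bounded_infdist_le:
  assumes "bounded S" "S \<noteq> {}"
  shows "bounded {x. infdist x S \<le> e}"
proof -
  obtain a r where r: "\<And>s. s \<in> S \<Longrightarrow> dist a s \<le> r"
    using assms(1) unfolding bounded_def by blast
  have "dist a x \<le> r + (e + 1)" if x: "infdist x S \<le> e" for x
  proof -
    have "(INF s\<in>S. dist x s) < e + 1" using x assms(2) by (simp add: infdist_notempty)
    then obtain s where s: "s \<in> S" "dist x s < e + 1"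
      using assms(2) by (subst (asm) cInf_less_iff) auto
    then show ?thesis using r[of s] dist_triangle2[of a x s] by simp
  qed
  then show ?thesis unfolding bounded_def by blast
qed

lemma bump_in_Lip_b:
  assumes "bounded S" "S \<noteq> {}"
  shows "bump S e \<in> Lip_b"
proof -
  have "closure {x. bump S e x \<noteq> 0} \<subseteq> {x. infdist x S \<le> e}"
    by (rule closure_minimal) (auto simp: bump_def intro!: closed_Collect_le continuous_intros)
  then have "bounded (closure {x. bump S e x \<noteq> 0})"
    using bounded_infdist_le[OF assms] bounded_subset by blast
  then show ?thesis unfolding Lip_b_def using bump_lipschitz by blast
qed

text \<open>Along a geodesic towards a nearest point of S, which exists because S is finite, the
  distance to S drops at unit speed, so the bump climbs at unit speed.\<close>

lemma bump_ascent:
  fixes x :: "'a::metric_space"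
  assumes "geodesic_space TYPE('a)" "finite S" "S \<noteq> {}"
    and "infdist x S \<le> e" "0 \<le> t" "t \<le> infdist x S"
  obtains z where "dist x z = t" "bump S e x + t \<le> bump S e z"
proof -
  obtain s where s: "s \<in> S" "infdist x S = dist x s"
    using finite_infdist_attained[OF assms(2,3)] .
  obtain z where z: "dist x z = t" "dist z s = dist x s - t"
    using geodesic_point[OF assms(1,5)] assms(6) s(2) by metis
  have "infdist z S \<le> infdist x S - t"
    using infdist_le[OF s(1), of z] z s by simp
  then have "bump S e x + t \<le> bump S e z" using assms by (simp add: bump_def)
  with z that show ?thesis by blast
qed

lemma lip_slope_bump_ge:
  fixes x :: "'a::metric_space"
  assumes "geodesic_space TYPE('a)" "finite S" "S \<noteq> {}"
    and "infdist x S \<le> e" "0 < infdist x S"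
  shows "ennreal (1/2) \<le> lip_slope (bump S e) x"
  unfolding lip_slope_def
proof (rule Liminf_bounded)
  have "\<forall>\<^sub>F r in at_right 0. 0 < r \<and> r < infdist x S"
    using assms(5) by (intro eventually_conj eventually_at_right_less eventually_at_right_real[THEN eventually_mono]) auto
  then show "\<forall>\<^sub>F r in at_right 0. ennreal (1/2) \<le> (SUP y\<in>ball x r. ennreal (\<bar>bump S e y - bump S e x\<bar> / r))"
  proof eventually_elim
    case (elim r)
    \<comment> \<open>The ball is open, so the point is taken at half its radius; this is the origin
      of the bound 1/2.\<close>
    obtain z where z: "dist x z = r / 2" "bump S e x + r / 2 \<le> bump S e z"
      using bump_ascent[OF assms(1-4), of "r / 2"] elim by auto
    show ?case
    proof (rule SUP_upper2)
      show "z \<in> ball x r" using z elim by simp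
      show "ennreal (1/2) \<le> ennreal (\<bar>bump S e z - bump S e x\<bar> / r)"
        using z elim by (intro ennreal_leI) (auto simp: field_simps)
    qed
  qed
qed

lemma Lip_slope_bump_eq_0:
  assumes "e < infdist x S"
  shows "Lip_slope (bump S e) x = 0"
proof -
  have "Lip_slope (bump S e) x \<le> 0"
    unfolding Lip_slope_def
  proof (rule Limsup_bounded)
    have "\<forall>\<^sub>F r in at_right 0. 0 < r \<and> r < infdist x S - e"
      using assms by (intro eventually_conj eventually_at_right_less eventually_at_right_real[THEN eventually_mono]) auto
    then show "\<forall>\<^sub>F r in at_right 0. (SUP y\<in>ball x r. ennreal (\<bar>bump S e y - bump S e x\<bar> / r)) \<le> 0"
    proof eventually_elim
      case (elim r)
      have "bump S e y = 0" if "y \<in> ball x r" for y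
        using that elim infdist_triangle[of x S y] assms by (auto simp: bump_def)
      moreover have "bump S e x = 0" using assms by (simp add: bump_def)
      ultimately show ?case by (intro SUP_least) simp
    qed
  qed
  then show ?thesis by simp
qed

context doubling_mms
begin

text \<open>On the slice the difference quotient is at least (d/r)^(N/p); if it is also at most s,
  then solving (d/r)^(N/p) \<le> s for d gives the radius. The bound s is demanded only on the
  slice, so that it may come from a local estimate.\<close>

lemma slice_subset:
  assumes "0 < r" "0 < s" "\<And>y. y \<in> slice u r x \<Longrightarrow> \<bar>u x - u y\<bar> \<le> s * dist x y"
  shows "slice u r x \<subseteq> cball x (r * s powr (p / N))"
proof
  fix y assume y: "y \<in> slice u r x"
  then have xy: "0 < dist x y" by (simp add: slice_def)
  have "dist x y * (dist x y / r) powr (N / p) \<le> \<bar>u x - u y\<bar>"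
    using y by (simp add: slice_def)
  also have "\<dots> \<le> s * dist x y" using y by (rule assms(3))
  finally have "dist x y * (dist x y / r) powr (N / p) \<le> s * dist x y" .
  then have "(dist x y / r) powr (N / p) \<le> s" using xy by simp
  then have "((dist x y / r) powr (N / p)) powr (p / N) \<le> s powr (p / N)"
    using N_pos p_pos by (intro powr_mono2) auto
  then have "dist x y / r \<le> s powr (p / N)"
    using assms(1) by (simp add: powr_exp_cancel)
  then show "y \<in> cball x (r * s powr (p / N))"
    using assms(1) by (simp add: divide_simps mult.commute)
qed

lemma Lip_energy_bump_le:
  "Lip_energy M p (bump S e) \<le> emeasure M {x. infdist x S \<le> e}"
proof -
  have "Lip_energy M p (bump S e) \<le> (\<integral>\<^sup>+x. indicator {x. infdist x S \<le> e} x \<partial>M)"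
    unfolding Lip_energy_def
  proof (rule nn_integral_mono)
    fix x
    have "enn2real (Lip_slope (bump S e) x) \<le> 1"
      using Lip_slope_le_lipschitz[OF bump_lipschitz, of S e x] by (simp add: enn2real_leI)
    then have "enn2real (Lip_slope (bump S e) x) powr p \<le> 1 powr p"
      using p_pos by (intro powr_mono2) auto
    then show "ennreal (enn2real (Lip_slope (bump S e) x) powr p) \<le> indicator {x. infdist x S \<le> e} x"
      using Lip_slope_bump_eq_0[of e x S] p_pos by (auto simp: indicator_def not_le)
  qed
  also have "\<dots> = emeasure M {x. infdist x S \<le> e}"
    by (rule nn_integral_indicator) (auto intro!: borel_closed closed_Collect_le continuous_intros)
  finally show ?thesis .
qed

text \<open>On A the lower slope is at least 1/2 and the upper slope at most 1. Points of S are
  excluded because the ascent towards S needs positive distance to it.\<close>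

lemma lip_energy_bump_ge:
  assumes "geodesic_space TYPE('a)" "finite S" "S \<noteq> {}" "A \<in> sets borel"
    and A: "\<And>x. x \<in> A \<Longrightarrow> infdist x S \<le> e \<and> 0 < infdist x S"
  shows "ennreal ((1/2) powr (N + p)) * emeasure M A \<le> lip_energy M N p (bump S e)"
proof -
  have "ennreal ((1/2) powr (N + p)) * emeasure M A = (\<integral>\<^sup>+x. ennreal ((1/2) powr (N + p)) * indicator A x \<partial>M)"
    using assms(4) by (subst nn_integral_cmult_indicator) auto
  also have "\<dots> \<le> lip_energy M N p (bump S e)"
    unfolding lip_energy_def
  proof (rule nn_integral_mono)
    fix x
    show "ennreal ((1/2) powr (N + p)) * indicator A x \<le> ennreal (enn2real (lip_slope (bump S e) x) powr (N + p) / enn2real (Lip_slope (bump S e) x) powr N)"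
    proof (cases "x \<in> A")
      case True
      let ?l = "enn2real (lip_slope (bump S e) x)" and ?L = "enn2real (Lip_slope (bump S e) x)"
      have 1: "Lip_slope (bump S e) x \<le> 1"
        using Lip_slope_le_lipschitz[OF bump_lipschitz, of S e x] by simp
      have 2: "ennreal (1/2) \<le> lip_slope (bump S e) x"
        using A[OF True] by (intro lip_slope_bump_ge assms) auto
      have fin: "lip_slope (bump S e) x < top" "Lip_slope (bump S e) x < top"
        using le_less_trans[OF 1] le_less_trans[OF order.trans[OF lip_slope_le_Lip_slope 1]] by simp_all
      have l: "1/2 \<le> ?l" using enn2real_mono[OF 2] fin by (simp only: enn2real_ennreal)
      have L: "?L \<le> 1" using 1 by (simp add: enn2real_leI)
      have "?l \<le> ?L" using lip_slope_le_Lip_slope fin by (intro enn2real_mono) auto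
      \<comment> \<open>Division by 0 would make the integrand 0, so the denominator has to be
        positive as well as at most 1.\<close>
      then have "0 < ?L" using l by linarith
      have "(1/2) powr (N + p) \<le> ?l powr (N + p)"
        using l N_pos p_pos by (intro powr_mono2) auto
      also have "\<dots> \<le> ?l powr (N + p) / ?L powr N"
        using L \<open>0 < ?L\<close> N_pos powr_mono2[of N ?L 1] by (simp add: divide_simps mult_left_le)
      finally show ?thesis using True by (simp add: ennreal_leI)
    qed simp
  qed
  finally show ?thesis .
qed

section \<open>Volume growth from the upper energy bound\<close>

text \<open>For the bump at x0 of height R, the functional is at least of order (V x0 R / R^N) times
  the volume of a ball comparable to B_R(x0), while its Lip energy is at most V x0 (2 R). Doubling
  cancels one volume and leaves a bound on V x0 R / R^N.\<close>

lemma ball_growth: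
  assumes geo: "geodesic_space TYPE('a)" and two: "\<exists>x y :: 'a. x \<noteq> y"
    and "0 < C2"
    and upper: "\<And>u. u \<in> Lip_b \<Longrightarrow> Limsup (at_right 0) (Q u) \<le> ennreal C2 * Lip_energy M p u"
  shows "\<exists>C>0. \<forall>x R. 0 < R \<longrightarrow> V x R \<le> C * R powr N"
proof -
  \<comment> \<open>Points v of the small ball satisfy d(x,v) < 3r/4, so their weight (d/r)^(N/p) is
    at most \<open>\<tau>\<close> < 1. The choice of \<open>\<delta>\<close> gives (1/2 + \<delta>)
    \<tau> \<le> 1/2 - \<delta>: the climb to v, at least r/2 - \<delta> r, beats the weighted
    distance.\<close>
  define \<tau> where "\<tau> = (3/4 :: real) powr (N / p)"
  define \<delta> where "\<delta> = (1 - \<tau>) / 4"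
  have \<tau>: "0 < \<tau>" "\<tau> < 1"
    using N_pos p_pos powr_less_mono2[of "N/p" "3/4" 1] by (auto simp: \<tau>_def)
  then have \<delta>: "0 < \<delta>" "\<delta> < 1/4" by (auto simp: \<delta>_def)
  have \<beta>0: "0 < \<beta>" using beta_gt_1 by simp
  \<comment> \<open>Four factors \<open>\<beta>\<close> come from \<open>\<kappa>\<close>; of the
    other four, one compares B_2R(x0) with B_R(x0) and three compare B_R(x0) with the ball of radius
    R/4 around y.\<close>
  define C where "C = C2 * \<beta> ^ 8 / \<delta> powr N"
  have C: "0 < C" using assms(3) \<beta>0 \<delta> by (simp add: C_def)
  have local: "V x0 R \<le> C * R powr N" if R: "0 < R" "R \<le> dist x0 w" for x0 w R
  proof -
    define u where "u = bump {x0} R"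
    obtain y where y: "dist x0 y = R / 2"
      using geodesic_point[OF geo, of "R / 2" x0 w] R by auto
    \<comment> \<open>The passage from B_R(x0) to the ball of radius \<delta> r around z uses
      \<open>V_ratio\<close> twice, each time after doubling a radius; each use costs
      \<open>\<beta> * \<beta>\<close>.\<close>
    define \<kappa> where "\<kappa> = V x0 R * \<delta> powr N / (\<beta> ^ 4 * R powr N)"
    have \<kappa>: "0 \<le> \<kappa>" using \<beta>0 by (simp add: \<kappa>_def)
    have slice: "ennreal (\<kappa> * r powr N) \<le> emeasure M (slice u r x)"
      if r: "0 < r" "r < R / 4" and x: "x \<in> ball y (R / 4)" for r x
    proof -
      have d: "R / 4 \<le> dist x x0" "dist x x0 \<le> R"
        using x y dist_triangle[of x0 y x] dist_triangle[of x x0 y] by (auto simp: dist_commute)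
      obtain z where z: "dist x z = r / 2" "u x + r / 2 \<le> u z"
        unfolding u_def using bump_ascent[OF geo, of "{x0}" x R "r / 2"] d r by auto
      have "ball z (\<delta> * r) \<subseteq> slice u r x"
      proof
        fix v assume "v \<in> ball z (\<delta> * r)"
        then have v: "dist z v < \<delta> * r" by simp
        have "\<delta> * r < r / 4" using \<delta> r by simp
        then have xv: "dist x v < (3/4) * r" "r / 4 < dist x v"
          using dist_triangle[of x v z] dist_triangle[of x z v] z v by (auto simp: dist_commute)
        have "u z - u v \<le> \<delta> * r"
          using bump_diff_le[of "{x0}" R z v] v by (simp add: u_def)
        then have uv: "r / 2 - \<delta> * r \<le> u v - u x" using z by linarith
        have "(dist x v / r) powr (N / p) \<le> \<tau>"
          unfolding \<tau>_def using xv r N_pos p_pos by (intro powr_mono2) (auto simp: field_simps)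
        then have "dist x v * (dist x v / r) powr (N / p) \<le> dist x v * \<tau>"
          by (intro mult_left_mono) auto
        also have "dist x v \<le> r / 2 + \<delta> * r"
          using dist_triangle[of x v z] z v by simp
        then have "dist x v * \<tau> \<le> (r / 2 + \<delta> * r) * \<tau>"
          using \<tau> by (intro mult_right_mono) auto
        also have "(r / 2 + \<delta> * r) * \<tau> \<le> r / 2 - \<delta> * r"
        proof -
          have "\<delta> * \<tau> \<le> \<delta>" using \<tau> \<delta> by simp
          moreover have "\<tau> = 1 - 4 * \<delta>" by (simp add: \<delta>_def field_simps)
          moreover have "(1/2 + \<delta>) * \<tau> = \<tau> / 2 + \<delta> * \<tau>" by (simp add: algebra_simps)
          ultimately have "(1/2 + \<delta>) * \<tau> \<le> 1/2 - \<delta>" by linarith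
          from mult_right_mono[OF this, of r] r show ?thesis by (simp add: algebra_simps)
        qed
        finally show "v \<in> slice u r x"
          using uv xv r by (auto simp: slice_def)
      qed
      then have "emeasure M (ball z (\<delta> * r)) \<le> emeasure M (slice u r x)"
        using r by (intro emeasure_mono) (auto simp: u_def continuous_on_bump)
      moreover have "\<kappa> * r powr N \<le> V z (\<delta> * r)"
      proof -
        have 1: "V x0 R \<le> V x (2 * R)" by (rule V_mono) (use d in \<open>simp add: dist_commute\<close>)
        have 2: "V x (2 * R) * r powr N \<le> \<beta> * V x r * (2 * R) powr N"
          by (rule V_ratio) (use r R in auto)
        have 3: "V x r \<le> V z (2 * r)" by (rule V_mono) (use z r in simp)
        have 4: "V z (2 * r) * (\<delta> * r) powr N \<le> \<beta> * V z (\<delta> * r) * (2 * r) powr N"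
          by (rule V_ratio) (use r \<delta> in auto)
        have 5: "V z (2 * r) * \<delta> powr N \<le> \<beta> * \<beta> * V z (\<delta> * r)"
          using 4 r \<delta> by (simp add: powr_mult beta_eq mult_ac)
        have "V x0 R * r powr N \<le> V x (2 * R) * r powr N"
          by (intro mult_right_mono 1) auto
        also note 2
        also have "\<beta> * V x r * (2 * R) powr N = \<beta> * \<beta> * R powr N * V x r"
          using R by (simp add: powr_mult beta_eq)
        also have "\<dots> \<le> \<beta> * \<beta> * R powr N * V z (2 * r)"
          using 3 \<beta>0 by (intro mult_left_mono) auto
        finally have "V x0 R * r powr N * \<delta> powr N \<le> \<beta> * \<beta> * R powr N * V z (2 * r) * \<delta> powr N"
          by (intro mult_right_mono) auto
        also have "\<dots> = \<beta> * \<beta> * R powr N * (V z (2 * r) * \<delta> powr N)" by simp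
        also have "\<dots> \<le> \<beta> * \<beta> * R powr N * (\<beta> * \<beta> * V z (\<delta> * r))"
          using 5 \<beta>0 by (intro mult_left_mono) auto
        finally show ?thesis
          using \<beta>0 R by (simp add: \<kappa>_def divide_simps power4_eq_xxxx mult_ac)
      qed
      ultimately show ?thesis
        by (metis emeasure_ball ennreal_leI order.trans)
    qed
    have "ennreal (\<kappa> * V y (R / 4)) \<le> Q u r" if r: "0 < r" "r < R / 4" for r
    proof -
      have "ennreal (\<kappa> * r powr N) * emeasure M (ball y (R/4)) = (\<integral>\<^sup>+x. ennreal (\<kappa> * r powr N) * indicator (ball y (R / 4)) x \<partial>M)"
        by (subst nn_integral_cmult_indicator) auto
      also have "\<dots> \<le> (\<integral>\<^sup>+x. emeasure M (slice u r x) \<partial>M)"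
        by (rule nn_integral_mono) (use slice[OF r] in \<open>auto simp: indicator_def\<close>)
      finally have "ennreal (r powr -N) * (ennreal (\<kappa> * r powr N) * emeasure M (ball y (R/4))) \<le> Q u r"
        unfolding Q_def by (rule mult_left_mono) simp
      moreover have "ennreal (r powr -N) * (ennreal (\<kappa> * r powr N) * emeasure M (ball y (R/4))) = ennreal (\<kappa> * V y (R / 4))"
        unfolding emeasure_ball using r \<kappa> by (simp add: ennreal_mult[symmetric] powr_minus field_simps)
      ultimately show ?thesis by simp
    qed
    then have "ennreal (\<kappa> * V y (R / 4)) \<le> Limsup (at_right 0) (Q u)"
      using R by (intro le_Limsup) (auto simp: eventually_at_right_field intro!: exI[of _ "R/4"])
    also have "\<dots> \<le> ennreal C2 * Lip_energy M p u"
      by (rule upper) (auto simp: u_def intro!: bump_in_Lip_b)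
    also have "\<dots> \<le> ennreal C2 * emeasure M (ball x0 (2 * R))"
    proof (rule mult_left_mono)
      have "Lip_energy M p u \<le> emeasure M {x. infdist x {x0} \<le> R}"
        unfolding u_def by (rule Lip_energy_bump_le)
      also have "\<dots> \<le> emeasure M (ball x0 (2 * R))"
        using R by (intro emeasure_mono) (auto simp: dist_commute)
      finally show "Lip_energy M p u \<le> emeasure M (ball x0 (2 * R))" .
    qed simp
    also have "\<dots> = ennreal (C2 * V x0 (2 * R))"
      unfolding emeasure_ball using assms(3) by (simp add: ennreal_mult)
    finally have "\<kappa> * V y (R / 4) \<le> C2 * V x0 (2 * R)"
      using assms(3) by (simp add: ennreal_le_iff)
    also have "\<dots> \<le> C2 * (\<beta> * V x0 R)"
      using doubling[OF R(1), of x0] assms(3) by (intro mult_left_mono) auto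
    finally have 1: "\<kappa> * V y (R / 4) \<le> C2 * \<beta> * V x0 R" by simp
    have "V x0 R \<le> V y (2 ^ 3 * (R / 4))" by (rule V_mono) (use y R in simp)
    also have "\<dots> \<le> \<beta> ^ 3 * V y (R / 4)" by (rule V_pow2) (use R in simp)
    finally have "\<kappa> * V x0 R \<le> \<kappa> * (\<beta> ^ 3 * V y (R / 4))"
      using \<kappa> by (rule mult_left_mono)
    also have "\<dots> = \<beta> ^ 3 * (\<kappa> * V y (R / 4))" by simp
    also have "\<dots> \<le> \<beta> ^ 3 * (C2 * \<beta> * V x0 R)"
      using 1 \<beta>0 by (intro mult_left_mono) auto
    finally have "\<kappa> \<le> \<beta> ^ 4 * C2"
      using V_pos[OF R(1), of x0] by (simp add: power4_eq_xxxx power3_eq_cube mult_ac)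
    then show ?thesis
      using \<beta>0 \<delta> R by (simp add: \<kappa>_def C_def divide_simps mult_ac eval_nat_numeral)
  qed
  show ?thesis
  proof (intro exI[of _ "\<beta> * C"] conjI allI impI)
    show "0 < \<beta> * C" using C \<beta>0 by simp
    fix x :: 'a and R :: real assume R: "0 < R"
    obtain w where w: "w \<noteq> x" using two by metis
    show "V x R \<le> \<beta> * C * R powr N"
    proof (cases "R \<le> dist x w")
      case True
      have "V x R \<le> 1 * (C * R powr N)" using local[OF R True] by simp
      also have "\<dots> \<le> \<beta> * (C * R powr N)"
        using beta_gt_1 C by (intro mult_right_mono) auto
      finally show ?thesis by simp
    next
      case False
      \<comment> \<open>Beyond the distance to w there may be no geodesic of the required length, as
        in a bounded space; near-monotonicity carries the bound from radius \<open>?r\<close> up to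
        R.\<close>
      let ?r = "dist x w"
      have r: "0 < ?r" using w by simp
      have "V x R * ?r powr N \<le> \<beta> * V x ?r * R powr N"
        using V_ratio[OF r] False by simp
      also have "\<dots> \<le> \<beta> * (C * ?r powr N) * R powr N"
        using local[OF r order_refl] \<beta>0 by (intro mult_right_mono mult_left_mono) auto
      finally show ?thesis using r by (simp add: mult_ac)
    qed
  qed
qed

section \<open>Positive lower density from the lower energy bound\<close>

text \<open>K is closed, so the shells shrink to the empty set; they are bounded, hence of finite
  measure, and continuity from above applies.\<close>

lemma emeasure_thickening:
  assumes "compact K" "K \<noteq> {}" "0 < \<epsilon>"
  shows "\<exists>d>0. emeasure M ({x. infdist x K < d} - K) < ennreal \<epsilon>"
proof -
  define A where "A n = {x. infdist x K < 1 / real (Suc n)} - K" for n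
  have A_sets: "A n \<in> sets M" for n
    unfolding A_def sets_M using assms(1)
    by (intro sets.Diff borel_open open_Collect_less continuous_intros borel_compact)
  have "bounded (A n)" for n
    by (rule bounded_subset[OF bounded_infdist_le[OF compact_imp_bounded[OF assms(1)] assms(2), of "1 / real (Suc n)"]])
      (auto simp: A_def)
  then have fin: "emeasure M (A n) \<noteq> \<infinity>" for n using emeasure_bounded_finite[of "A n"] by simp
  have "decseq A"
    unfolding decseq_def
  proof (intro allI impI)
    fix m n :: nat assume "m \<le> n"
    then have "1 / real (Suc n) \<le> 1 / real (Suc m)" by (simp add: divide_simps)
    then show "A n \<subseteq> A m" by (auto simp: A_def)
  qed
  then have "(\<lambda>n. emeasure M (A n)) \<longlonglongrightarrow> emeasure M (\<Inter>n. A n)"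
    using A_sets fin by (intro Lim_emeasure_decseq) auto
  also have "(\<Inter>n. A n) = {}"
  proof (rule equals0I)
    fix x assume x: "x \<in> (\<Inter>n. A n)"
    then have "x \<notin> K" "\<And>n. infdist x K < 1 / real (Suc n)" by (auto simp: A_def)
    moreover have "0 < infdist x K"
      using \<open>x \<notin> K\<close> assms by (intro infdist_pos_not_in_closed compact_imp_closed)
    ultimately show False
      using nat_approx_posE[of "infdist x K"] by (meson less_asym)
  qed
  finally have "\<forall>\<^sub>F n in sequentially. emeasure M (A n) < ennreal \<epsilon>"
    using assms(3) by (intro order_tendstoD(2)[where y = 0]) auto
  then obtain n where "emeasure M (A n) < ennreal \<epsilon>"
    by (auto simp: eventually_sequentially)
  then show ?thesis unfolding A_def by (intro exI[of _ "1 / real (Suc n)"]) auto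
qed

lemma emeasure_eq_SUP_compact:
  "A \<in> sets borel \<Longrightarrow> emeasure M A = (SUP K\<in>{K. compact K \<and> K \<subseteq> A}. emeasure M K)"
  using mms by (auto simp: metric_measure_space_def radon_measure_def)

text \<open>Needed for inner regularity. B_R(x) lies in a slightly larger ball around a nearby point
  of the set, and the bound is continuous in the radius; this uses that the growth condition is
  imposed at every radius.\<close>

lemma closed_small_growth: "closed {x. \<forall>R>0. V x R \<le> c * R powr N}"
  unfolding closed_sequential_limits
proof (intro allI impI CollectI)
  fix X :: "nat \<Rightarrow> 'a" and x :: 'a and R :: real
  assume X: "(\<forall>n. X n \<in> {x. \<forall>R>0. V x R \<le> c * R powr N}) \<and> X \<longlonglongrightarrow> x" and R: "0 < R"
  have "(\<lambda>n. c * (R + dist (X n) x) powr N) \<longlonglongrightarrow> c * (R + dist x x) powr N"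
    using X R by (intro tendsto_intros) auto
  moreover have "V x R \<le> c * (R + dist (X n) x) powr N" for n
  proof -
    have "V x R \<le> V (X n) (R + dist (X n) x)" by (rule V_mono) (simp add: dist_commute)
    also have "\<dots> \<le> c * (R + dist (X n) x) powr N"
      using X add_pos_nonneg[OF R zero_le_dist[of "X n" x]] by blast
    finally show ?thesis .
  qed
  ultimately show "V x R \<le> c * R powr N"
    using LIMSEQ_le_const[of "\<lambda>n. c * (R + dist (X n) x) powr N" _ "V x R"] by auto
qed

text \<open>For compact K inside the set, the energy of the net bump is at least (1/2)^(N+p) m(K)
  for every mesh size e. For r < e the functional is at most \<beta> c m(K) plus a multiple of the
  measure of a thin shell around K. For c below the stated threshold this is compatible only with
  m(K) = 0.\<close>

lemma small_growth_null:
  assumes geo: "geodesic_space TYPE('a)" and "0 < C1" "0 < C"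
    and growth: "\<And>x R. 0 < R \<Longrightarrow> V x R \<le> C * R powr N"
    and lower: "\<And>u. u \<in> Lip_b \<Longrightarrow> ennreal C1 * lip_energy M N p u \<le> Liminf (at_right 0) (Q u)"
    and c: "0 < c" "\<beta> * c < C1 * (1/2) powr (N + p)"
  shows "emeasure M {x. \<forall>R>0. V x R \<le> c * R powr N} = 0"
proof -
  let ?Z = "{x. \<forall>R>0. V x R \<le> c * R powr N}"
  have \<beta>0: "0 < \<beta>" using beta_gt_1 by simp
  have "emeasure M K = 0" if K: "compact K" "K \<subseteq> ?Z" for K
  proof (cases "K = {}")
    case False
    have bK: "bounded K" "closed K" using K(1) by (auto simp: compact_imp_bounded compact_imp_closed)
    then have K_sets: "K \<in> sets M" by simp
    have key: "C1 * (1/2) powr (N + p) * measure M K \<le> \<beta> * c * measure M K + \<beta> * C * \<epsilon>" if "0 < \<epsilon>" for \<epsilon>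
    proof -
      obtain d where d: "0 < d" "emeasure M ({x. infdist x K < d} - K) < ennreal \<epsilon>"
        using emeasure_thickening[OF K(1) False \<open>0 < \<epsilon>\<close>] by blast
      \<comment> \<open>Half of d: a pair of length at most r < e that starts at distance at least d
        from K has both ends at distance at least e from S, where u vanishes.\<close>
      define e where "e = d / 2"
      have e: "0 < e" using d by (simp add: e_def)
      obtain S where S: "finite S" "S \<subseteq> K" "K \<subseteq> (\<Union>s\<in>S. ball s e)"
        using compactE_image[OF K(1), of K "\<lambda>s. ball s e"] e by force
      then have S_ne: "S \<noteq> {}" using False by auto
      have S_sets: "S \<in> sets borel" using S(1) by (intro borel_closed finite_imp_closed)
      define u where "u = bump S e"
      define W where "W = {x. infdist x K < d}"
      have W_sets: "W \<in> sets M"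
        unfolding W_def by (auto intro!: borel_open open_Collect_less continuous_intros)
      \<comment> \<open>The growth bound excludes atoms, so removing the finite net from K, as the
        energy estimate requires, costs no measure.\<close>
      have "emeasure M {s} = 0" for s
      proof -
        have "(\<lambda>n. C * inverse (real (Suc n)) powr N) \<longlonglongrightarrow> C * 0"
          using N_pos LIMSEQ_inverse_real_of_nat by (intro tendsto_mult tendsto_const tendsto_zero_powrI) auto
        moreover have "measure M {s} \<le> C * inverse (real (Suc n)) powr N" for n
        proof -
          have "measure M {s} \<le> V s (inverse (real (Suc n)))" by (rule measure_mono_bounded) auto
          also have "\<dots> \<le> C * inverse (real (Suc n)) powr N" by (rule growth) simp
          finally show ?thesis .
        qed
        ultimately have "measure M {s} \<le> C * 0" by (intro LIMSEQ_le_const) auto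
        then show ?thesis using emeasure_bounded[of "{s}"] measure_nonneg[of M "{s}"] by simp
      qed
      then have "emeasure M S = 0"
        using S(1) by (subst emeasure_eq_sum_singleton) (auto intro: finite_imp_closed)
      then have "S \<in> null_sets M" using S_sets by (intro null_setsI) auto
      then have mK: "emeasure M (K - S) = emeasure M K"
        using K_sets by (rule emeasure_Diff_null_set)
      have "ennreal ((1/2) powr (N + p)) * emeasure M (K - S) \<le> lip_energy M N p u"
        unfolding u_def
      proof (rule lip_energy_bump_ge[OF geo S(1) S_ne])
        show "K - S \<in> sets borel" using K_sets S_sets by auto
        fix x assume x: "x \<in> K - S"
        then obtain s where "s \<in> S" "dist s x < e" using S(3) by auto
        then have "infdist x S \<le> e" using infdist_le[of s S x] by (simp add: dist_commute)
        moreover have "0 < infdist x S"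
          using x S(1) S_ne by (intro infdist_pos_not_in_closed) (auto intro: finite_imp_closed)
        ultimately show "infdist x S \<le> e \<and> 0 < infdist x S" by simp
      qed
      then have "ennreal C1 * (ennreal ((1/2) powr (N + p)) * emeasure M K) \<le> ennreal C1 * lip_energy M N p u"
        unfolding mK by (rule mult_left_mono) simp
      also have "\<dots> \<le> Liminf (at_right 0) (Q u)"
        by (rule lower) (use S S_ne in \<open>auto simp: u_def intro!: bump_in_Lip_b finite_imp_bounded\<close>)
      also have "\<dots> \<le> ennreal (\<beta> * c * measure M K + \<beta> * C * \<epsilon>)"
      proof (rule Liminf_le)
        have "\<forall>\<^sub>F r in at_right 0. 0 < r \<and> r < e"
          using e by (intro eventually_conj eventually_at_right_less eventually_at_right_real[THEN eventually_mono]) auto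
        then show "\<forall>\<^sub>F r in at_right 0. Q u r \<le> ennreal (\<beta> * c * measure M K + \<beta> * C * \<epsilon>)"
        proof eventually_elim
          case (elim r)
          then have r: "0 < r" "r < e" by auto
          \<comment> \<open>The bump is 1-Lipschitz, so the slope bound is s = 1. Enlarging the
            closed ball to the open ball of radius 2 r produces the factor \<open>\<beta>\<close>
            below.\<close>
          have sl: "slice u r x \<subseteq> cball x r" for x
            using slice_subset[of r 1 u x] r bump_diff_le[of S e] by (simp add: u_def)
          have V_slice: "emeasure M (slice u r x) \<le> ennreal (V x (2 * r))" for x
            unfolding emeasure_ball[symmetric] using sl[of x] r by (intro emeasure_mono) auto
          have empty: "slice u r x = {}" if x: "x \<notin> W" for x
          proof (rule equals0I)
            fix y assume y: "y \<in> slice u r x"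
            then have dxy: "dist x y \<le> r" "x \<noteq> y" using sl[of x] by (auto simp: slice_def)
            have dS: "d \<le> infdist x S"
              using x infdist_mono[OF S(2) S_ne, of x] by (simp add: W_def)
            then have "e \<le> infdist y S" "e \<le> infdist x S"
              using infdist_triangle[of x S y] dxy r e by (auto simp: e_def)
            then have "u x = 0" "u y = 0" by (auto simp: u_def bump_def)
            then have "dist x y * (dist x y / r) powr (N / p) \<le> 0" using y by (simp add: slice_def)
            then show False using dxy r by (simp add: mult_le_0_iff)
          qed
          have pw: "(2 * r) powr N = \<beta> * r powr N" using r by (simp add: powr_mult beta_eq)
          have "(\<integral>\<^sup>+x. emeasure M (slice u r x) \<partial>M) \<le> (\<integral>\<^sup>+x. ennreal (c * (2 * r) powr N) * indicator K x + ennreal (C * (2 * r) powr N) * indicator (W - K) x \<partial>M)"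
          proof (rule nn_integral_mono)
            fix x
            consider "x \<in> K" | "x \<in> W - K" | "x \<notin> K" "x \<notin> W" by blast
            then show "emeasure M (slice u r x) \<le> ennreal (c * (2 * r) powr N) * indicator K x + ennreal (C * (2 * r) powr N) * indicator (W - K) x"
            proof cases
              case 1
              then have "V x (2 * r) \<le> c * (2 * r) powr N" using K(2) r by auto
              then show ?thesis using 1 V_slice[of x] by (auto intro: order.trans ennreal_leI)
            next
              case 2
              then show ?thesis using V_slice[of x] growth[of "2 * r" x] r by (auto intro: order.trans ennreal_leI)
            qed (simp add: empty)
          qed
          also have "\<dots> = ennreal (c * (2 * r) powr N) * emeasure M K + ennreal (C * (2 * r) powr N) * emeasure M (W - K)"
            using K_sets W_sets by (subst nn_integral_add) (auto simp: nn_integral_cmult_indicator sets.Diff)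
          also have "\<dots> \<le> ennreal (c * (2 * r) powr N) * ennreal (measure M K) + ennreal (C * (2 * r) powr N) * ennreal \<epsilon>"
            using d(2) emeasure_bounded[OF bK(1)] by (intro add_mono mult_left_mono) (auto simp: W_def)
          also have "\<dots> = ennreal (r powr N * (\<beta> * c * measure M K + \<beta> * C * \<epsilon>))"
            unfolding pw using \<beta>0 c \<open>0 < C\<close> \<open>0 < \<epsilon>\<close>
            by (simp add: ennreal_mult[symmetric] ennreal_plus[symmetric] algebra_simps del: ennreal_plus)
          finally have "Q u r \<le> ennreal (r powr - N) * ennreal (r powr N * (\<beta> * c * measure M K + \<beta> * C * \<epsilon>))"
            unfolding Q_def by (rule mult_left_mono) simp
          also have "\<dots> = ennreal (\<beta> * c * measure M K + \<beta> * C * \<epsilon>)"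
          proof -
            have "r powr - N * (r powr N * z) = z" for z
              using r by (simp add: powr_minus)
            then show ?thesis by (simp only: ennreal_mult'[symmetric] powr_ge_zero)
          qed
          finally show ?case .
        qed
      qed simp
      finally have "ennreal (C1 * (1/2) powr (N + p) * measure M K) \<le> ennreal (\<beta> * c * measure M K + \<beta> * C * \<epsilon>)"
        unfolding emeasure_bounded[OF bK(1)] using \<open>0 < C1\<close> by (simp add: ennreal_mult'[symmetric] mult.assoc)
      then show ?thesis using \<beta>0 c \<open>0 < C\<close> \<open>0 < \<epsilon>\<close> by (subst (asm) ennreal_le_iff) auto
    qed
    \<comment> \<open>The shell measure is arbitrary, so its contribution disappears.\<close>
    have "C1 * (1/2) powr (N + p) * measure M K \<le> \<beta> * c * measure M K"
    proof (rule field_le_epsilon)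
      fix t :: real assume t: "0 < t"
      then show "C1 * (1/2) powr (N + p) * measure M K \<le> \<beta> * c * measure M K + t"
        using key[of "t / (\<beta> * C)"] \<beta>0 \<open>0 < C\<close> by simp
    qed
    then have "(C1 * (1/2) powr (N + p) - \<beta> * c) * measure M K \<le> 0" by (simp add: algebra_simps)
    then have "measure M K \<le> 0" using c by (simp add: mult_le_0_iff)
    then show ?thesis using emeasure_bounded[OF bK(1)] by (simp add: ennreal_neg)
  qed simp
  then show ?thesis
    using emeasure_eq_SUP_compact[OF borel_closed[OF closed_small_growth[of c]]] by (simp add: SUP_constant bot_ennreal)
qed

end

section \<open>Energy bounds from density bounds\<close>

text \<open>The slope divides by the radius of the ball rather than by the distance. A radius just
  above \<open>dist x y\<close> converts one quotient into the other.\<close>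

lemma Lip_slope_lessD:
  assumes "Lip_slope u x < ennreal s" "0 < s"
  shows "\<exists>d>0. \<forall>y. dist x y < d \<longrightarrow> \<bar>u x - u y\<bar> \<le> s * dist x y"
proof -
  have "\<forall>\<^sub>F r in at_right 0. (SUP y\<in>ball x r. ennreal (\<bar>u y - u x\<bar> / r)) < ennreal s"
    using assms(1) unfolding Lip_slope_def by (rule Limsup_lessD)
  then obtain d where d: "0 < d" "\<And>r. 0 < r \<Longrightarrow> r < d \<Longrightarrow> (SUP y\<in>ball x r. ennreal (\<bar>u y - u x\<bar> / r)) < ennreal s"
    unfolding eventually_at_right_field by auto
  have "\<bar>u x - u y\<bar> \<le> s * dist x y" if y: "dist x y < d" for y
  proof (rule ccontr)
    assume "\<not> ?thesis"
    then have "dist x y < min d (\<bar>u x - u y\<bar> / s)"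
      using y assms(2) by (simp add: field_simps)
    then obtain r where r: "dist x y < r" "r < d" "r < \<bar>u x - u y\<bar> / s"
      using dense by (metis min_less_iff_conj)
    then have r0: "0 < r" using zero_le_dist[of x y] by linarith
    have "ennreal (\<bar>u y - u x\<bar> / r) \<le> (SUP y\<in>ball x r. ennreal (\<bar>u y - u x\<bar> / r))"
      using r by (intro SUP_upper) simp
    also have "\<dots> < ennreal s" using d(2) r r0 by simp
    finally have "\<bar>u y - u x\<bar> / r < s" by (simp add: ennreal_less_iff r0 less_imp_le)
    then show False using r(3) r0 assms(2) by (simp add: field_simps abs_minus_commute)
  qed
  with d(1) show ?thesis by blast
qed

lemma less_lip_slopeD:
  assumes "ennreal s < lip_slope u x" "0 \<le> s"
  shows "\<exists>d>0. \<forall>r>0. r < d \<longrightarrow> (\<exists>y\<in>ball x r. s * r < \<bar>u y - u x\<bar>)"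
proof -
  have "\<forall>\<^sub>F r in at_right 0. ennreal s < (SUP y\<in>ball x r. ennreal (\<bar>u y - u x\<bar> / r))"
    using assms(1) unfolding lip_slope_def by (rule less_LiminfD)
  then obtain d where d: "0 < d" "\<And>r. 0 < r \<Longrightarrow> r < d \<Longrightarrow> ennreal s < (SUP y\<in>ball x r. ennreal (\<bar>u y - u x\<bar> / r))"
    unfolding eventually_at_right_field by auto
  have "\<exists>y\<in>ball x r. s * r < \<bar>u y - u x\<bar>" if r: "0 < r" "r < d" for r
  proof -
    obtain y where "y \<in> ball x r" "ennreal s < ennreal (\<bar>u y - u x\<bar> / r)"
      using d(2)[OF r] unfolding less_SUP_iff by blast
    moreover from this(2) have "s < \<bar>u y - u x\<bar> / r"
      using assms(2) by (simp add: ennreal_less_iff)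
    ultimately show ?thesis using r(1) by (auto simp: pos_less_divide_eq)
  qed
  with d(1) show ?thesis by blast
qed

text \<open>The slopes are not known to be measurable, so the two comparisons below keep the scalar
  on a measurable bound instead of pulling it out of the integral.\<close>

lemma nn_integral_cmult_le:
  fixes f h :: "'a \<Rightarrow> ennreal"
  assumes "h \<in> borel_measurable M" "0 < c" "\<And>x. ennreal c * f x \<le> h x"
  shows "ennreal c * (\<integral>\<^sup>+x. f x \<partial>M) \<le> (\<integral>\<^sup>+x. h x \<partial>M)"
proof -
  have c: "ennreal (1 / c) * ennreal c = 1" using assms(2) by (simp add: ennreal_mult[symmetric])
  have "f x \<le> ennreal (1 / c) * h x" for x
    using mult_left_mono[OF assms(3)[of x], of "ennreal (1 / c)"] by (simp add: mult.assoc[symmetric] c)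
  then have "(\<integral>\<^sup>+x. f x \<partial>M) \<le> (\<integral>\<^sup>+x. ennreal (1 / c) * h x \<partial>M)" by (rule nn_integral_mono)
  also have "\<dots> = ennreal (1 / c) * (\<integral>\<^sup>+x. h x \<partial>M)" by (rule nn_integral_cmult) fact
  finally have "ennreal c * (\<integral>\<^sup>+x. f x \<partial>M) \<le> ennreal c * (ennreal (1 / c) * (\<integral>\<^sup>+x. h x \<partial>M))"
    by (rule mult_left_mono) simp
  then show ?thesis by (simp only: mult.assoc[symmetric] mult.commute[of "ennreal c" "ennreal (1 / c)"] c mult_1)
qed

lemma nn_integral_le_cmult:
  fixes f h :: "'a \<Rightarrow> ennreal"
  assumes "h \<in> borel_measurable M" "0 < c" "AE x in M. h x \<le> ennreal c * f x"
  shows "(\<integral>\<^sup>+x. h x \<partial>M) \<le> ennreal c * (\<integral>\<^sup>+x. f x \<partial>M)"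
proof -
  have c: "ennreal (1 / c) * ennreal c = 1" using assms(2) by (simp add: ennreal_mult[symmetric])
  have "ennreal (1 / c) * (\<integral>\<^sup>+x. h x \<partial>M) = (\<integral>\<^sup>+x. ennreal (1 / c) * h x \<partial>M)"
    by (rule nn_integral_cmult[symmetric]) fact
  also have "\<dots> \<le> (\<integral>\<^sup>+x. f x \<partial>M)"
  proof (rule nn_integral_mono_AE, use assms(3) in eventually_elim)
    case (elim x)
    from mult_left_mono[OF this, of "ennreal (1 / c)"]
    show ?case by (simp add: mult.assoc[symmetric] c)
  qed
  finally have "ennreal c * (ennreal (1 / c) * (\<integral>\<^sup>+x. h x \<partial>M)) \<le> ennreal c * (\<integral>\<^sup>+x. f x \<partial>M)"
    by (rule mult_left_mono) simp
  then show ?thesis by (simp only: mult.assoc[symmetric] mult.commute[of "ennreal c" "ennreal (1 / c)"] c mult_1)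
qed

section \<open>Gluing lower bounds over overlapping pieces\<close>

text \<open>A finite maximum of the weighted indicators is built one piece at a time. The new piece
  is used exactly where its value exceeds the previous maximum, and superadditivity of liminf joins
  the two regions; monotone convergence then gives the supremum. The regions are not known
  beforehand, hence the hypothesis on every measurable part of a piece.\<close>

lemma nn_integral_SUP_indicator_le_liminf:
  fixes f :: "nat \<Rightarrow> 'a \<Rightarrow> ennreal" and F :: "nat \<Rightarrow> ennreal" and W :: "nat \<Rightarrow> 'a set"
  assumes f: "\<And>n. f n \<in> borel_measurable M" and W: "\<And>w. W w \<in> sets M"
    and le: "\<And>w A. A \<in> sets M \<Longrightarrow> A \<subseteq> W w \<Longrightarrow>
      F w * emeasure M A \<le> liminf (\<lambda>n. \<integral>\<^sup>+x. f n x * indicator A x \<partial>M)"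
  shows "(\<integral>\<^sup>+x. (SUP w. F w * indicator (W w) x) \<partial>M) \<le> liminf (\<lambda>n. \<integral>\<^sup>+x. f n x \<partial>M)"
proof -
  note [measurable] = f W
  define h where "h m x = (SUP w\<in>{..<m}. F w * indicator (W w) x)" for m x
  have h_meas [measurable]: "h m \<in> borel_measurable M" for m
    unfolding h_def by (intro borel_measurable_SUP) auto
  have h_Suc: "h (Suc m) x = sup (F m * indicator (W m) x) (h m x)" for m x
    by (simp add: h_def lessThan_Suc)
  have part: "(\<integral>\<^sup>+x. h m x * indicator A x \<partial>M) \<le> liminf (\<lambda>n. \<integral>\<^sup>+x. f n x * indicator A x \<partial>M)"
    if "A \<in> sets M" for m A
    using that
  proof (induction m arbitrary: A)
    case 0
    then show ?case by (simp add: h_def bot_ennreal)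
  next
    case (Suc m)
    note [measurable] = Suc.prems
    \<comment> \<open>The region where the new value wins; on its complement in A the maximum is
      unchanged and the induction hypothesis applies.\<close>
    define B where "B = {x \<in> space M. x \<in> A \<inter> W m \<and> h m x < F m}"
    have B [measurable]: "B \<in> sets M" unfolding B_def by measurable
    have BA: "B \<subseteq> A" by (auto simp: B_def)
    have split: "g x * indicator A x = g x * indicator B x + g x * indicator (A - B) x" for g :: "'a \<Rightarrow> ennreal" and x
      using BA by (auto simp: indicator_def)
    have "(\<integral>\<^sup>+x. h (Suc m) x * indicator A x \<partial>M) = (\<integral>\<^sup>+x. F m * indicator B x + h m x * indicator (A - B) x \<partial>M)"
    proof (rule nn_integral_cong)
      fix x assume "x \<in> space M"
      then show "h (Suc m) x * indicator A x = F m * indicator B x + h m x * indicator (A - B) x"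
        by (auto simp: h_Suc B_def indicator_def not_less sup.absorb1 sup.absorb2 less_imp_le)
    qed
    also have "\<dots> = F m * emeasure M B + (\<integral>\<^sup>+x. h m x * indicator (A - B) x \<partial>M)"
      by (subst nn_integral_add) (auto simp: nn_integral_cmult_indicator)
    also have "\<dots> \<le> liminf (\<lambda>n. \<integral>\<^sup>+x. f n x * indicator B x \<partial>M) + liminf (\<lambda>n. \<integral>\<^sup>+x. f n x * indicator (A - B) x \<partial>M)"
      by (intro add_mono le Suc.IH) (auto simp: B_def)
    also have "\<dots> \<le> liminf (\<lambda>n. (\<integral>\<^sup>+x. f n x * indicator B x \<partial>M) + (\<integral>\<^sup>+x. f n x * indicator (A - B) x \<partial>M))"
      by (rule liminf_superadditive_ennreal)
    also have "\<dots> = liminf (\<lambda>n. \<integral>\<^sup>+x. f n x * indicator A x \<partial>M)"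
      by (subst split) (simp add: nn_integral_add)
    finally show ?case .
  qed
  have "(\<integral>\<^sup>+x. (SUP w. F w * indicator (W w) x) \<partial>M) = (\<integral>\<^sup>+x. (SUP m. h m x) \<partial>M)"
  proof (rule nn_integral_cong, rule antisym)
    fix x
    show "(SUP w. F w * indicator (W w) x) \<le> (SUP m. h m x)"
    proof (rule SUP_least)
      fix w
      have "F w * indicator (W w) x \<le> h (Suc w) x" by (simp add: h_Suc)
      also have "\<dots> \<le> (SUP m. h m x)" by (rule SUP_upper) simp
      finally show "F w * indicator (W w) x \<le> (SUP m. h m x)" .
    qed
    show "(SUP m. h m x) \<le> (SUP w. F w * indicator (W w) x)"
      unfolding h_def by (intro SUP_least) (auto intro: SUP_upper)
  qed
  also have "\<dots> = (SUP m. \<integral>\<^sup>+x. h m x \<partial>M)"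
    by (rule nn_integral_monotone_convergence_SUP) (auto simp: incseq_Suc_iff le_fun_def h_Suc)
  also have "\<dots> \<le> liminf (\<lambda>n. \<integral>\<^sup>+x. f n x \<partial>M)"
  proof (rule SUP_least)
    fix m
    have e: "(\<integral>\<^sup>+x. g x * indicator (space M) x \<partial>M) = (\<integral>\<^sup>+x. g x \<partial>M)" for g :: "'a \<Rightarrow> ennreal"
      by (rule nn_integral_cong) auto
    show "(\<integral>\<^sup>+x. h m x \<partial>M) \<le> liminf (\<lambda>n. \<integral>\<^sup>+x. f n x \<partial>M)"
      using part[OF sets.top, of m] by (simp only: e)
  qed
  finally show ?thesis .
qed

context doubling_mms
begin

section \<open>Densities and volume growth\<close>

lemma ball_quotient: "0 < r \<Longrightarrow> emeasure M (ball x r) / ennreal (r powr N) = ennreal (V x r / r powr N)"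
  unfolding emeasure_ball by (rule divide_ennreal) auto

lemma V_quotient_antimono:
  assumes "0 < r" "r \<le> R"
  shows "V x R / (\<beta> * R powr N) \<le> V x r / r powr N"
  using V_ratio[OF assms, of x] assms beta_gt_1 by (simp add: field_simps)

lemma growth_of_upper_density:
  assumes "upper_density M N x \<le> ennreal a" "0 \<le> a" "0 < R"
  shows "V x R \<le> \<beta> * a * R powr N"
proof -
  have "ennreal (V x R / (\<beta> * R powr N)) \<le> upper_density M N x"
    unfolding upper_density_def
  proof (rule le_Limsup)
    have "\<forall>\<^sub>F r in at_right 0. 0 < r \<and> r < R"
      using assms(3) by (intro eventually_conj eventually_at_right_less eventually_at_right_real[THEN eventually_mono]) auto
    then show "\<forall>\<^sub>F r in at_right 0. ennreal (V x R / (\<beta> * R powr N)) \<le> emeasure M (ball x r) / ennreal (r powr N)"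
      by eventually_elim (auto simp: ball_quotient intro!: ennreal_leI V_quotient_antimono)
  qed simp
  also note assms(1)
  finally have "V x R / (\<beta> * R powr N) \<le> a" using assms(2) by (simp add: ennreal_le_iff)
  then show ?thesis using assms(3) beta_gt_1 by (simp add: field_simps)
qed

lemma upper_density_of_growth:
  assumes "\<And>R. 0 < R \<Longrightarrow> V x R \<le> C * R powr N"
  shows "upper_density M N x \<le> ennreal C"
  unfolding upper_density_def
proof (rule Limsup_bounded)
  show "\<forall>\<^sub>F r in at_right 0. emeasure M (ball x r) / ennreal (r powr N) \<le> ennreal C"
    using eventually_at_right_less[of "0::real"]
  proof eventually_elim
    case (elim r)
    then show ?case using assms[OF elim] by (auto simp: ball_quotient field_simps intro!: ennreal_leI)
  qed
qed

text \<open>One scale with large volume suffices: near-monotonicity passes the bound to all smaller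
  radii, at the price of \<open>\<beta>\<close>.\<close>

lemma lower_density_ge:
  assumes "0 < R" "\<beta> * a * R powr N < V x R"
  shows "ennreal a \<le> lower_density M N x"
  unfolding lower_density_def
proof (rule Liminf_bounded)
  have "\<forall>\<^sub>F r in at_right 0. 0 < r \<and> r < R"
    using assms(1) by (intro eventually_conj eventually_at_right_less eventually_at_right_real[THEN eventually_mono]) auto
  then show "\<forall>\<^sub>F r in at_right 0. ennreal a \<le> emeasure M (ball x r) / ennreal (r powr N)"
  proof eventually_elim
    case (elim r)
    have "a \<le> V x R / (\<beta> * R powr N)"
      using assms beta_gt_1 by (simp add: field_simps)
    also have "\<dots> \<le> V x r / r powr N" using elim by (intro V_quotient_antimono) auto
    finally show ?case using elim by (simp add: ball_quotient ennreal_leI)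
  qed
qed

lemma lower_densityD:
  assumes "ennreal a \<le> lower_density M N x" "0 < a"
  shows "\<forall>\<^sub>F r in at_right 0. a / 2 * r powr N \<le> V x r"
proof -
  have "ennreal (a / 2) < ennreal a" using assms(2) by (simp add: ennreal_less_iff)
  then have "ennreal (a / 2) < lower_density M N x" using assms(1) by (rule less_le_trans)
  then have "\<forall>\<^sub>F r in at_right 0. ennreal (a / 2) < emeasure M (ball x r) / ennreal (r powr N)"
    unfolding lower_density_def by (rule less_LiminfD)
  then show ?thesis
    using eventually_at_right_less[of "0::real"]
  proof eventually_elim
    case (elim r)
    then have "a / 2 < V x r / r powr N" using assms(2) by (simp add: ball_quotient ennreal_less_iff)
    then show ?case using elim(2) by (simp add: field_simps)
  qed
qed

section \<open>The upper energy bound\<close>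

lemma Q_eq_integral:
  "0 < r \<Longrightarrow> continuous_on UNIV u \<Longrightarrow> Q u r = (\<integral>\<^sup>+x. ennreal (r powr - N) * emeasure M (slice u r x) \<partial>M)"
  unfolding Q_def by (rule nn_integral_cmult[symmetric]) (simp add: slice_measurable cong: measurable_cong_sets)

text \<open>The N-th power of the radius r s^(p/N) is r^N s^p, which is how the p-th power of the
  slope enters. Passing from the closed ball to an open one of twice the radius costs
  \<open>\<beta>\<close>.\<close>

lemma slice_bound:
  assumes "0 < r" "0 < s" "\<And>y. y \<in> slice u r x \<Longrightarrow> \<bar>u x - u y\<bar> \<le> s * dist x y"
    and growth: "\<And>R. 0 < R \<Longrightarrow> V x R \<le> A * R powr N"
  shows "ennreal (r powr - N) * emeasure M (slice u r x) \<le> ennreal (A * \<beta> * s powr p)"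
proof -
  let ?R = "2 * (r * s powr (p / N))"
  have R: "0 < ?R" using assms by simp
  have "slice u r x \<subseteq> cball x (r * s powr (p / N))" by (rule slice_subset[OF assms(1-3)])
  also have "\<dots> \<subseteq> ball x ?R" using R by auto
  finally have "emeasure M (slice u r x) \<le> emeasure M (ball x ?R)" by (rule emeasure_mono) simp
  also have "\<dots> \<le> ennreal (A * ?R powr N)"
    unfolding emeasure_ball by (intro ennreal_leI growth R)
  also have "?R powr N = \<beta> * (r powr N * s powr p)"
    using assms(1,2) powr_exp_cancel(2)[of s] by (simp add: powr_mult beta_eq)
  finally have "ennreal (r powr - N) * emeasure M (slice u r x) \<le> ennreal (r powr - N) * ennreal (A * (\<beta> * (r powr N * s powr p)))"
    by (rule mult_left_mono) simp
  also have "\<dots> = ennreal (A * \<beta> * s powr p)"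
    using assms(1) by (simp add: ennreal_mult'[symmetric] powr_minus field_simps)
  finally show ?thesis .
qed

text \<open>Two slope bounds act in turn: the global Lipschitz constant shrinks the slices to x,
  after which any s > Lip(u)(x) is a valid bound on them. Finally s decreases to Lip(u)(x).\<close>

lemma limsup_slice_le:
  assumes "L-lipschitz_on UNIV u"
    and growth: "\<And>R. 0 < R \<Longrightarrow> V x R \<le> A * R powr N"
    and X: "\<And>n. 0 < X n" "X \<longlonglongrightarrow> 0"
  shows "limsup (\<lambda>n. ennreal (X n powr - N) * emeasure M (slice u (X n) x))
    \<le> ennreal (A * \<beta>) * ennreal (enn2real (Lip_slope u x) powr p)"
proof -
  let ?l = "enn2real (Lip_slope u x)"
  define L' where "L' = max L 1"
  have L': "0 < L'" "\<And>y. \<bar>u x - u y\<bar> \<le> L' * dist x y"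
  proof -
    show "\<bar>u x - u y\<bar> \<le> L' * dist x y" for y
      using lipschitz_onD[OF assms(1), of x y] mult_right_mono[of L L' "dist x y"]
      by (simp add: L'_def dist_real_def)
  qed (simp add: L'_def)
  have "V x 1 \<le> A" using growth[of 1] by simp
  then have A: "0 \<le> A" by (rule order.trans[OF measure_nonneg])
  have fin: "Lip_slope u x < top"
    using Lip_slope_le_lipschitz[OF assms(1), of x] by (rule le_less_trans) simp
  have 1: "limsup (\<lambda>n. ennreal (X n powr - N) * emeasure M (slice u (X n) x)) \<le> ennreal (A * \<beta> * s powr p)"
    if s: "?l < s" for s
  proof -
    have s0: "0 < s" using s enn2real_nonneg[of "Lip_slope u x"] by linarith
    have "Lip_slope u x < ennreal s"
      using s fin by (metis enn2real_nonneg ennreal_enn2real ennreal_lessI s0)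
    then obtain d where d: "0 < d" "\<And>y. dist x y < d \<Longrightarrow> \<bar>u x - u y\<bar> \<le> s * dist x y"
      using Lip_slope_lessD[OF _ s0] by blast
    have "(\<lambda>n. X n * L' powr (p / N)) \<longlonglongrightarrow> 0 * L' powr (p / N)"
      by (intro tendsto_mult X tendsto_const)
    then have "\<forall>\<^sub>F n in sequentially. X n * L' powr (p / N) < d"
      using d(1) by (intro order_tendstoD) auto
    then show ?thesis
    proof (intro Limsup_bounded, eventually_elim)
      case (elim n)
      show ?case
      proof (rule slice_bound[OF X(1) s0 _ growth])
        fix y assume "y \<in> slice u (X n) x"
        then have "dist x y \<le> X n * L' powr (p / N)"
          using subsetD[OF slice_subset[OF X(1) L'(1) L'(2)]] by simp
        then show "\<bar>u x - u y\<bar> \<le> s * dist x y" using elim by (intro d) simp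
      qed
    qed
  qed
  have "(\<lambda>n. A * \<beta> * (?l + inverse (real (Suc n))) powr p) \<longlonglongrightarrow> A * \<beta> * (?l + 0) powr p"
    using p_pos by (intro tendsto_mult tendsto_const tendsto_powr2 tendsto_add LIMSEQ_inverse_real_of_nat) auto
  then have "(\<lambda>n. ennreal (A * \<beta> * (?l + inverse (real (Suc n))) powr p)) \<longlonglongrightarrow> ennreal (A * \<beta> * (?l + 0) powr p)"
    by (rule tendsto_ennrealI)
  then have "limsup (\<lambda>n. ennreal (X n powr - N) * emeasure M (slice u (X n) x)) \<le> ennreal (A * \<beta> * (?l + 0) powr p)"
    by (rule LIMSEQ_le_const) (use 1 in auto)
  then show ?thesis using A beta_gt_1 by (simp add: ennreal_mult)
qed

lemma Limsup_Q_le: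
  assumes u: "u \<in> Lip_b" and "0 < A"
    and growth: "AE x in M. \<forall>R>0. V x R \<le> A * R powr N"
  shows "Limsup (at_right 0) (Q u) \<le> ennreal (A * \<beta>) * Lip_energy M p u"
proof -
  have \<beta>0: "0 < \<beta>" using beta_gt_1 by simp
  obtain L0 where L0: "L0-lipschitz_on UNIV u" using u by (auto simp: Lip_b_def)
  define L where "L = max L0 1"
  have L: "L-lipschitz_on UNIV u" using L0 by (rule lipschitz_on_le) (simp add: L_def)
  have L_pos: "0 < L" by (simp add: L_def)
  have Lu: "\<bar>u x - u y\<bar> \<le> L * dist x y" for x y
    using lipschitz_onD[OF L, of x y] by (simp add: dist_real_def)
  have cont: "continuous_on UNIV u" using L by (rule lipschitz_on_continuous_on)
  have "bounded {x. u x \<noteq> 0}"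
    using u bounded_subset[OF _ closure_subset] by (auto simp: Lip_b_def)
  then obtain x0 \<rho> where \<rho>: "{x. u x \<noteq> 0} \<subseteq> cball x0 \<rho>"
    using bounded_subset_ballD[of _ undefined] ball_subset_cball by (metis order.trans)
  \<comment> \<open>For radii below \<open>\<delta>\<close> every slice has reach at most 1, so
    slices are empty outside the ball of radius \<rho> + 1 and a constant on that ball is an
    integrable majorant.\<close>
  define \<delta> where "\<delta> = 1 / L powr (p / N)"
  have \<delta>: "0 < \<delta>" using L_pos by (simp add: \<delta>_def)
  show ?thesis
  proof (rule Limsup_at_right_0_sequentially_le[OF \<delta>])
    fix X :: "nat \<Rightarrow> real"
    assume X: "\<And>n. 0 < X n" "\<And>n. X n < \<delta>" "X \<longlonglongrightarrow> 0"
    let ?f = "\<lambda>n x. ennreal (X n powr - N) * emeasure M (slice u (X n) x)"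
    have f [measurable]: "?f n \<in> borel_measurable M" for n
      using slice_measurable[OF X(1) cont] by (intro borel_measurable_times_ennreal) (auto cong: measurable_cong_sets)
    let ?w = "\<lambda>x. ennreal (A * \<beta> * L powr p) * indicator (cball x0 (\<rho> + 1)) x"
    have "limsup (\<lambda>n. Q u (X n)) = limsup (\<lambda>n. \<integral>\<^sup>+x. ?f n x \<partial>M)"
      by (simp add: Q_eq_integral[OF X(1) cont])
    also have "\<dots> \<le> (\<integral>\<^sup>+x. limsup (\<lambda>n. ?f n x) \<partial>M)"
    proof (rule nn_integral_limsup[where w = ?w])
      show "AE x in M. ?f n x \<le> ?w x" for n
        using growth
      proof eventually_elim
        case (elim x)
        show ?case
        proof (cases "x \<in> cball x0 (\<rho> + 1)")
          case True
          have "?f n x \<le> ennreal (A * \<beta> * L powr p)"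
            by (rule slice_bound[OF X(1) L_pos Lu]) (use elim in auto)
          then show ?thesis using True by simp
        next
          case False
          have "slice u (X n) x = {}"
          proof (rule equals0I)
            fix y assume y: "y \<in> slice u (X n) x"
            have "dist x y \<le> X n * L powr (p / N)"
              using subsetD[OF slice_subset[OF X(1) L_pos Lu] y] by simp
            also have "\<dots> \<le> 1" using X(2)[of n] L_pos by (simp add: \<delta>_def field_simps)
            finally have "y \<notin> cball x0 \<rho>" "x \<notin> cball x0 \<rho>"
              using False dist_triangle[of x0 x y] by (auto simp: dist_commute)
            then have "u x = 0" "u y = 0" using \<rho> by auto
            then have "dist x y * (dist x y / X n) powr (N / p) \<le> 0" "0 < dist x y" using y by (simp_all add: slice_def)
            moreover have "0 < dist x y * (dist x y / X n) powr (N / p)"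
              using X(1)[of n] \<open>0 < dist x y\<close> by simp
            ultimately show False by simp
          qed
          then show ?thesis by simp
        qed
      qed
      show "(\<integral>\<^sup>+x. ?w x \<partial>M) < \<infinity>"
        by (subst nn_integral_cmult_indicator) (simp_all add: emeasure_bounded ennreal_mult_less_top)
      show "?w \<in> borel_measurable M"
        by (intro borel_measurable_times_ennreal borel_measurable_const borel_measurable_indicator) simp
    qed (rule f)
    also have "\<dots> \<le> ennreal (A * \<beta>) * Lip_energy M p u"
      unfolding Lip_energy_def
    proof (rule nn_integral_le_cmult)
      show "AE x in M. limsup (\<lambda>n. ?f n x) \<le> ennreal (A * \<beta>) * ennreal (enn2real (Lip_slope u x) powr p)"
        using growth by eventually_elim (rule limsup_slice_le[OF L _ X(1,3)], auto)
      show "(\<lambda>x. limsup (\<lambda>n. ?f n x)) \<in> borel_measurable M"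
        using f by (rule borel_measurable_limsup)
      show "0 < A * \<beta>" using \<open>0 < A\<close> \<beta>0 by simp
    qed
    finally show "limsup (\<lambda>n. Q u (X n)) \<le> ennreal (A * \<beta>) * Lip_energy M p u" .
  qed
qed

section \<open>The lower energy bound\<close>

lemma dist_less_sets: "{xz :: 'a \<times> 'a. dist (fst xz) (snd xz) < r} \<in> sets (M \<Otimes>\<^sub>M M)"
  unfolding sets_pair by (intro borel_open open_Collect_less continuous_intros)

text \<open>H1 and H2 are the two slope bounds made uniform on K below the scale r0. The normalised
  ball volumes \<open>G\<close> are dominated by the slice term plus an error \<open>E\<close> from
  balls that leave K; Fatou's lemma and the lower density bound \<open>G\<close> from below, and
  \<open>E\<close> tends to 0.\<close>

lemma liminf_slice_ge_compact:
  assumes cont: "continuous_on UNIV u" and K: "compact K" and "0 < a" "a \<le> b" "0 < r0" "0 < A" "0 < a1"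
    and H1: "\<And>x y. x \<in> K \<Longrightarrow> dist x y < r0 \<Longrightarrow> \<bar>u x - u y\<bar> \<le> b * dist x y"
    and H2: "\<And>x R. x \<in> K \<Longrightarrow> 0 < R \<Longrightarrow> R < r0 \<Longrightarrow> \<exists>y\<in>ball x R. a * R \<le> \<bar>u y - u x\<bar>"
    and growth: "AE x in M. \<forall>R>0. V x R \<le> A * R powr N"
    and dens: "AE x in M. \<forall>\<^sub>F r in at_right 0. a1 * r powr N \<le> V x r"
    and X: "\<And>n. 0 < X n" "X \<longlonglongrightarrow> 0"
  shows "ennreal (a1 / (6 powr N * 4 powr p * \<beta> ^ 3) * (a powr (N + p) / b powr N)) * emeasure M K
    \<le> liminf (\<lambda>n. \<integral>\<^sup>+x. ennreal (X n powr - N) * emeasure M (slice u (X n) x) * indicator K x \<partial>M)"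
    (is "?lhs \<le> liminf ?F")
proof (cases "K = {}")
  case False
  have \<beta>0: "0 < \<beta>" using beta_gt_1 by simp
  have b0: "0 < b" using assms by linarith
  \<comment> \<open>With k in K inside the small ball, u varies from y to any z there by at most 3 b
    \<delta> R = a R / 2, so half of the variation a R survives. The choice of \<open>\<rho>\<close>
    makes the slice threshold at distance 2 R equal to 2 R (a/4), the same a R / 2.\<close>
  define \<delta> where "\<delta> = a / (6 * b)"
  define \<rho> where "\<rho> = (a / 4) powr (p / N) / 2"
  have \<delta>: "0 < \<delta>" "\<delta> < 1" "6 * b * \<delta> = a" using assms b0 by (auto simp: \<delta>_def field_simps)
  have \<rho>: "0 < \<rho>" "(2 * \<rho>) powr (N / p) = a / 4"
    using assms(3) by (auto simp: \<rho>_def powr_exp_cancel)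
  have \<rho>N: "\<rho> powr N = (a / 4) powr p / \<beta>"
  proof -
    have "\<rho> powr N = ((a / 4) powr (p / N)) powr N / 2 powr N"
      unfolding \<rho>_def by (rule powr_divide)
    then show ?thesis using assms(3) powr_exp_cancel(2)[of "a / 4"] by (simp add: beta_eq)
  qed
  define c0 where "c0 = \<delta> powr N / \<beta> ^ 2"
  have c0: "0 < c0" using \<delta> \<beta>0 by (simp add: c0_def)
  have K_sets [measurable]: "K \<in> sets borel" using K by (rule borel_compact)
  define R where "R n = \<rho> * X n" for n
  have R: "0 < R n" for n using \<rho> X by (simp add: R_def)
  have R_lim: "R \<longlonglongrightarrow> 0" unfolding R_def using tendsto_mult[OF tendsto_const X(2), of \<rho>] by simp
  have X_R: "X n powr - N = \<rho> powr N * R n powr - N" for n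
    using \<rho>(1) X(1)[of n] by (simp add: R_def powr_mult powr_minus)
  text \<open>Either the small ball misses \<open>K\<close>, or a point of \<open>K\<close> in it transfers the local
    Lipschitz bound to that ball, which then lies in the slice.\<close>
  have point: "ennreal (c0 * V x (R n)) \<le> emeasure M (slice u (X n) x) + emeasure M (ball x (2 * R n) - K)"
    if x: "x \<in> K" and n: "4 * R n < r0" for x n
  proof -
    have Rn: "R n < r0" using n R[of n] by linarith
    obtain y where y: "dist x y < R n" "a * R n \<le> \<bar>u y - u x\<bar>"
      using H2[OF x R Rn] by auto
    let ?B = "ball y (\<delta> * R n)"
    have \<delta>R: "\<delta> * R n < R n" using \<delta> R[of n] by simp
    have B_sub: "?B \<subseteq> ball x (2 * R n)"
    proof
      fix z assume "z \<in> ?B"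
      then show "z \<in> ball x (2 * R n)" using y \<delta>R dist_triangle[of x z y] by simp
    qed
    have "emeasure M ?B \<le> emeasure M (slice u (X n) x) + emeasure M (ball x (2 * R n) - K)"
    proof (cases "?B \<inter> K = {}")
      case True
      then have "emeasure M ?B \<le> emeasure M (ball x (2 * R n) - K)"
        using B_sub by (intro emeasure_mono) auto
      then show ?thesis by (rule order.trans) simp
    next
      case False
      then obtain k where k: "k \<in> K" "dist y k < \<delta> * R n" by auto
      have "?B \<subseteq> slice u (X n) x"
      proof
        fix z assume z: "z \<in> ?B"
        have kz: "dist k z < 2 * (\<delta> * R n)"
          using z k dist_triangle[of k z y] by (simp add: dist_commute)
        have ky: "dist k y < \<delta> * R n" using k by (simp add: dist_commute)
        have "dist k z < r0" "dist k y < r0" using kz ky \<delta>R n R[of n] by linarith+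
        then have "\<bar>u k - u z\<bar> \<le> b * dist k z" "\<bar>u k - u y\<bar> \<le> b * dist k y"
          by (auto intro!: H1[OF k(1)])
        moreover have "b * dist k z \<le> b * (2 * (\<delta> * R n))" "b * dist k y \<le> b * (\<delta> * R n)"
          using kz ky b0 by auto
        moreover have "b * (2 * (\<delta> * R n)) + b * (\<delta> * R n) = a * R n / 2"
          using \<delta>(3) by (simp add: algebra_simps flip: \<delta>(3))
        ultimately have uxz: "a * R n / 2 \<le> \<bar>u x - u z\<bar>" using y(2) by linarith
        have "0 < a * R n" using assms(3) R[of n] by simp
        then have "x \<noteq> z" using uxz by auto
        have xz: "dist x z < 2 * R n" using z B_sub by auto
        have "(dist x z / X n) powr (N / p) \<le> (2 * \<rho>) powr (N / p)"
          using xz X(1)[of n] N_pos p_pos by (intro powr_mono2) (auto simp: R_def field_simps)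
        then have "dist x z * (dist x z / X n) powr (N / p) \<le> (2 * R n) * (a / 4)"
          unfolding \<rho>(2) using xz R[of n] by (intro mult_mono) auto
        then show "z \<in> slice u (X n) x" using uxz \<open>x \<noteq> z\<close> by (simp add: slice_def)
      qed
      then have "emeasure M ?B \<le> emeasure M (slice u (X n) x)"
        using slice_sets[OF X(1) cont] by (intro emeasure_mono) auto
      then show ?thesis by (rule order.trans) simp
    qed
    moreover have "c0 * V x (R n) \<le> V y (\<delta> * R n)"
    proof -
      have "V y (2 * R n) * (\<delta> * R n) powr N \<le> \<beta> * V y (\<delta> * R n) * (2 * R n) powr N"
        using \<delta> \<delta>R R[of n] by (intro V_ratio) auto
      then have "V y (2 * R n) * \<delta> powr N \<le> \<beta> ^ 2 * V y (\<delta> * R n)"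
        using \<delta> R[of n] by (simp add: powr_mult beta_eq power2_eq_square mult_ac)
      moreover have "V x (R n) * \<delta> powr N \<le> V y (2 * R n) * \<delta> powr N"
        using y by (intro mult_right_mono V_mono) (auto simp: dist_commute)
      ultimately show ?thesis using \<beta>0 by (simp add: c0_def field_simps)
    qed
    ultimately show ?thesis
      by (metis emeasure_ball ennreal_leI order.trans)
  qed
  define G where "G n x = ennreal (c0 * \<rho> powr N * (V x (R n) * R n powr - N)) * indicator K x" for n x
  have G_meas [measurable]: "G n \<in> borel_measurable M" for n
    unfolding G_def by measurable
  define E where "E n = ennreal (X n powr - N) * (\<integral>\<^sup>+x. emeasure M (ball x (2 * R n) - K) * indicator K x \<partial>M)" for n
  have lower: "ennreal (c0 * \<rho> powr N * a1) * emeasure M K \<le> liminf (\<lambda>n. \<integral>\<^sup>+x. G n x \<partial>M)"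
  proof -
    have "ennreal (c0 * \<rho> powr N * a1) * emeasure M K = (\<integral>\<^sup>+x. ennreal (c0 * \<rho> powr N * a1) * indicator K x \<partial>M)"
      by (subst nn_integral_cmult_indicator) auto
    also have "\<dots> \<le> (\<integral>\<^sup>+x. liminf (\<lambda>n. G n x) \<partial>M)"
    proof (rule nn_integral_mono_AE, use dens in eventually_elim)
      case (elim x)
      have "filterlim R (at_right 0) sequentially"
        using R_lim R by (intro tendsto_imp_filterlim_at_right) auto
      from eventually_compose_filterlim[OF elim this]
      have "\<forall>\<^sub>F n in sequentially. a1 * R n powr N \<le> V x (R n)" .
      then show ?case
      proof (intro Liminf_bounded, eventually_elim)
        case (elim n)
        then have "a1 \<le> V x (R n) * R n powr - N"
          using R[of n] by (simp add: powr_minus field_simps)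
        then have "c0 * \<rho> powr N * a1 \<le> c0 * \<rho> powr N * (V x (R n) * R n powr - N)"
          using c0 by (intro mult_left_mono) auto
        then show ?case unfolding G_def by (intro mult_right_mono ennreal_leI) auto
      qed
    qed
    also have "\<dots> \<le> liminf (\<lambda>n. \<integral>\<^sup>+x. G n x \<partial>M)" by (rule nn_integral_liminf) simp
    finally show ?thesis .
  qed
  have GFE: "\<forall>\<^sub>F n in sequentially. (\<integral>\<^sup>+x. G n x \<partial>M) \<le> ?F n + E n"
  proof -
    have "\<forall>\<^sub>F n in sequentially. R n < r0 / 4"
      using R_lim \<open>0 < r0\<close> by (intro order_tendstoD) auto
    then show ?thesis
    proof eventually_elim
      case (elim n)
      then have n: "4 * R n < r0" by simp
      have "(UNIV \<times> - K) \<inter> {xz. dist (fst xz) (snd xz) < 2 * R n} \<in> sets (M \<Otimes>\<^sub>M M)"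
        by (intro sets.Int pair_measureI dist_less_sets) auto
      from M1.measurable_emeasure_Pair[OF this]
      have "(\<lambda>x. emeasure M (Pair x -` ((UNIV \<times> - K) \<inter> {xz. dist (fst xz) (snd xz) < 2 * R n}))) \<in> borel_measurable M" .
      moreover have "Pair x -` ((UNIV \<times> - K) \<inter> {xz. dist (fst xz) (snd xz) < 2 * R n}) = ball x (2 * R n) - K" for x
        by auto
      ultimately have [measurable]: "(\<lambda>x. emeasure M (ball x (2 * R n) - K)) \<in> borel_measurable M"
        by (simp only:)
      have [measurable]: "(\<lambda>x. emeasure M (slice u (X n) x)) \<in> borel_measurable M"
        using slice_measurable[OF X(1) cont] by (simp cong: measurable_cong_sets)
      have "(\<integral>\<^sup>+x. G n x \<partial>M) \<le> (\<integral>\<^sup>+x. ennreal (X n powr - N) * emeasure M (slice u (X n) x) * indicator K x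
          + ennreal (X n powr - N) * (emeasure M (ball x (2 * R n) - K) * indicator K x) \<partial>M)"
      proof (rule nn_integral_mono)
        fix x
        show "G n x \<le> ennreal (X n powr - N) * emeasure M (slice u (X n) x) * indicator K x
          + ennreal (X n powr - N) * (emeasure M (ball x (2 * R n) - K) * indicator K x)"
        proof (cases "x \<in> K")
          case True
          have "G n x = ennreal (X n powr - N) * ennreal (c0 * V x (R n))"
            using True c0 by (simp add: G_def X_R ennreal_mult'[symmetric] mult_ac)
          also have "\<dots> \<le> ennreal (X n powr - N) * (emeasure M (slice u (X n) x) + emeasure M (ball x (2 * R n) - K))"
            by (intro mult_left_mono point True n) simp
          finally show ?thesis using True by (simp add: distrib_left)
        qed (simp add: G_def)
      qed
      also have "\<dots> = ?F n + E n"
        unfolding E_def by (subst nn_integral_add) (auto simp: nn_integral_cmult)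
      finally show ?case .
    qed
  qed
  have E_small: "\<forall>\<^sub>F n in sequentially. E n \<le> ennreal \<epsilon>" if "0 < \<epsilon>" for \<epsilon>
  proof -
    define \<epsilon>' where "\<epsilon>' = \<epsilon> / (A * \<beta> * \<rho> powr N)"
    have \<epsilon>': "0 < \<epsilon>'" using that \<open>0 < A\<close> \<beta>0 \<rho> by (simp add: \<epsilon>'_def)
    obtain d where d: "0 < d" "emeasure M ({x. infdist x K < d} - K) < ennreal \<epsilon>'"
      using emeasure_thickening[OF K False \<epsilon>'] by blast
    have "\<forall>\<^sub>F n in sequentially. R n < d / 2"
      using R_lim d(1) by (intro order_tendstoD) auto
    then show ?thesis
    proof eventually_elim
      case (elim n)
      define P where "P = (K \<times> - K) \<inter> {xz. dist (fst xz) (snd xz) < 2 * R n}"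
      have P_sets: "P \<in> sets (M \<Otimes>\<^sub>M M)"
        unfolding P_def by (intro sets.Int pair_measureI dist_less_sets) auto
      define D where "D = {x. infdist x K < d} - K"
      have D_sets: "D \<in> sets M"
        unfolding D_def sets_M by (intro sets.Diff borel_open open_Collect_less continuous_intros K_sets)
      have "(\<integral>\<^sup>+x. emeasure M (ball x (2 * R n) - K) * indicator K x \<partial>M) = (\<integral>\<^sup>+x. emeasure M (Pair x -` P) \<partial>M)"
      proof (rule nn_integral_cong)
        fix x
        have "Pair x -` P = (if x \<in> K then ball x (2 * R n) - K else {})"
          by (auto simp: P_def)
        then show "emeasure M (ball x (2 * R n) - K) * indicator K x = emeasure M (Pair x -` P)"
          by simp
      qed
      also have "\<dots> = emeasure (M \<Otimes>\<^sub>M M) P"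
        by (rule M1.emeasure_pair_measure_alt[OF P_sets, symmetric])
      also have "\<dots> = (\<integral>\<^sup>+z. emeasure M ((\<lambda>x. (x, z)) -` P) \<partial>M)"
        by (rule emeasure_pair_measure_alt2[OF P_sets])
      \<comment> \<open>After exchanging the order of integration the outer variable z lies off K
        but within 2 R n of it, hence in the thin shell D. Growth is used at z, and its factor (2 R
        n)^N compensates X n^(-N).\<close>
      also have "\<dots> \<le> (\<integral>\<^sup>+z. ennreal (A * (2 * R n) powr N) * indicator D z \<partial>M)"
      proof (rule nn_integral_mono_AE, use growth in eventually_elim)
        case (elim z)
        show ?case
        proof (cases "(\<lambda>x. (x, z)) -` P = {}")
          case False
          then obtain x where x: "x \<in> K" "z \<notin> K" "dist x z < 2 * R n"
            by (auto simp: P_def split: if_splits)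
          then have "z \<in> D" using infdist_le[OF x(1), of z] \<open>R n < d / 2\<close> by (auto simp: D_def dist_commute)
          have "emeasure M ((\<lambda>x. (x, z)) -` P) \<le> emeasure M (ball z (2 * R n))"
            by (intro emeasure_mono) (auto simp: P_def dist_commute)
          also have "\<dots> \<le> ennreal (A * (2 * R n) powr N)"
            unfolding emeasure_ball using elim R[of n] by (intro ennreal_leI) auto
          finally show ?thesis using \<open>z \<in> D\<close> by simp
        qed simp
      qed
      also have "\<dots> = ennreal (A * (2 * R n) powr N) * emeasure M D"
        using D_sets by (rule nn_integral_cmult_indicator)
      also have "\<dots> \<le> ennreal (A * (2 * R n) powr N) * ennreal \<epsilon>'"
        using d(2) unfolding D_def by (intro mult_left_mono) auto
      finally have "E n \<le> ennreal (X n powr - N) * (ennreal (A * (2 * R n) powr N) * ennreal \<epsilon>')"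
        unfolding E_def by (rule mult_left_mono) simp
      also have "\<dots> = ennreal (X n powr - N * (A * (2 * R n) powr N * \<epsilon>'))"
        using \<open>0 < A\<close> \<epsilon>' by (simp add: ennreal_mult'[symmetric])
      also have "X n powr - N * (A * (2 * R n) powr N * \<epsilon>') = \<epsilon>"
        unfolding X_R \<epsilon>'_def using R[of n] \<open>0 < A\<close> \<beta>0 \<rho> by (simp add: powr_mult powr_minus beta_eq field_simps)
      finally show ?case .
    qed
  qed
  have "liminf (\<lambda>n. \<integral>\<^sup>+x. G n x \<partial>M) \<le> liminf ?F"
  proof (rule ennreal_le_epsilon)
    fix \<epsilon> :: real assume \<epsilon>: "0 < \<epsilon>"
    have "liminf (\<lambda>n. \<integral>\<^sup>+x. G n x \<partial>M) \<le> liminf (\<lambda>n. ?F n + ennreal \<epsilon>)"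
    proof (rule Liminf_mono, use GFE E_small[OF \<epsilon>] in eventually_elim)
      case (elim n)
      note elim(1)
      also have "?F n + E n \<le> ?F n + ennreal \<epsilon>" using elim(2) by (rule add_left_mono)
      finally show ?case .
    qed
    also have "\<dots> = liminf ?F + ennreal \<epsilon>" by (rule Liminf_add_const) simp
    finally show "liminf (\<lambda>n. \<integral>\<^sup>+x. G n x \<partial>M) \<le> liminf ?F + ennreal \<epsilon>" .
  qed
  with lower have "ennreal (c0 * \<rho> powr N * a1) * emeasure M K \<le> liminf ?F" by (rule order.trans)
  moreover have "c0 * \<rho> powr N * a1 = a1 / (6 powr N * 4 powr p * \<beta> ^ 3) * (a powr (N + p) / b powr N)"
    using assms(3) b0 \<beta>0
    by (simp add: c0_def \<delta>_def \<rho>N powr_divide powr_mult powr_add field_simps power2_eq_square power3_eq_cube)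
  ultimately show ?thesis by simp
qed simp

text \<open>X is covered, up to points where lip(u) = 0, by countably many pieces indexed by
  rational slope bounds a, b and a scale 1/(n+1). Inner regularity passes from compact sets to
  measurable parts of a piece, and the gluing lemma does the rest. The factor 4^(N+p) has a 2 from
  using rational radii and a 2 from choosing a > lip/2; 2^N comes from b < 2 Lip.\<close>

lemma liminf_slice_ge:
  assumes u: "u \<in> Lip_b" and "0 < A" "0 < a1"
    and growth: "AE x in M. \<forall>R>0. V x R \<le> A * R powr N"
    and dens: "AE x in M. \<forall>\<^sub>F r in at_right 0. a1 * r powr N \<le> V x r"
    and X: "\<And>n. 0 < X n" "X \<longlonglongrightarrow> 0"
  shows "ennreal (a1 / (6 powr N * 4 powr p * \<beta> ^ 3) / (4 powr (N + p) * 2 powr N)) * lip_energy M N p u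
    \<le> liminf (\<lambda>n. Q u (X n))"
proof -
  have \<beta>0: "0 < \<beta>" using beta_gt_1 by simp
  define \<kappa> where "\<kappa> = a1 / (6 powr N * 4 powr p * \<beta> ^ 3)"
  have \<kappa>: "0 < \<kappa>" using \<open>0 < a1\<close> \<beta>0 by (simp add: \<kappa>_def)
  obtain L where L: "L-lipschitz_on UNIV u" using u by (auto simp: Lip_b_def)
  have cont: "continuous_on UNIV u" using L by (rule lipschitz_on_continuous_on)
  let ?f = "\<lambda>n x. ennreal (X n powr - N) * emeasure M (slice u (X n) x)"
  have f: "?f n \<in> borel_measurable M" for n
    using slice_measurable[OF X(1) cont] by (intro borel_measurable_times_ennreal) (auto cong: measurable_cong_sets)
  \<comment> \<open>Rational radii turn this set into a countable intersection of open sets; with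
    all real radii its measurability would be unclear.\<close>
  define S1 where "S1 a n = {x. \<forall>q::rat. 0 < q \<longrightarrow> q < 1 / of_nat (Suc n) \<longrightarrow> (\<exists>y\<in>ball x (real_of_rat q). a * real_of_rat q < \<bar>u y - u x\<bar>)}" for a n
  define S2 where "S2 b n = {x. \<forall>y. dist x y < 1 / real (Suc n) \<longrightarrow> \<bar>u x - u y\<bar> \<le> b * dist x y}" for b n
  define W where "W w = (case from_nat w of (a, b, n) \<Rightarrow> S1 (real_of_rat a) n \<inter> S2 (real_of_rat b) n)" for w
  \<comment> \<open>Triples with a nonpositive a or b carry no information and receive the neutral
    value 0.\<close>
  define F where "F w = (case from_nat w of (a :: rat, b :: rat, n :: nat) \<Rightarrow>
     if 0 < a \<and> 0 < b then ennreal (\<kappa> * ((real_of_rat a / 2) powr (N + p) / real_of_rat b powr N)) else 0)" for w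
  have S1_sets: "S1 a n \<in> sets borel" for a n
  proof -
    have "{x. \<exists>y\<in>ball x t. c < \<bar>u y - u x\<bar>} \<in> sets borel" for t c
    proof -
      have "{x. \<exists>y\<in>ball x t. c < \<bar>u y - u x\<bar>} = (\<Union>y. {x. dist x y < t} \<inter> {x. c < \<bar>u y - u x\<bar>})"
        by auto
      also have "open \<dots>"
        using cont by (intro open_UN ballI open_Int open_Collect_less continuous_intros) auto
      finally show ?thesis by simp
    qed
    then have "(\<Inter>q\<in>{q::rat. 0 < q \<and> q < 1 / of_nat (Suc n)}. {x. \<exists>y\<in>ball x (real_of_rat q). a * real_of_rat q < \<bar>u y - u x\<bar>}) \<in> sets borel"
      by (intro sets.countable_INT'') auto
    also have "(\<Inter>q\<in>{q::rat. 0 < q \<and> q < 1 / of_nat (Suc n)}. {x. \<exists>y\<in>ball x (real_of_rat q). a * real_of_rat q < \<bar>u y - u x\<bar>}) = S1 a n"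
      unfolding S1_def by auto
    finally show ?thesis .
  qed
  have S2_sets: "S2 b n \<in> sets borel" for b n
  proof -
    have "S2 b n = (\<Inter>y. {x. 1 / real (Suc n) \<le> dist x y} \<union> {x. \<bar>u x - u y\<bar> \<le> b * dist x y})"
      unfolding S2_def by (intro set_eqI) (simp only: mem_Collect_eq INT_iff Un_iff not_le[symmetric] imp_conv_disj not_not UNIV_I ball_UNIV)
    also have "closed \<dots>"
      using cont by (intro closed_INT ballI closed_Un closed_Collect_le continuous_intros) auto
    finally show ?thesis by simp
  qed
  have W_sets: "W w \<in> sets M" for w
    unfolding W_def using S1_sets S2_sets by (auto split: prod.split)
  have le: "F w * emeasure M B \<le> liminf (\<lambda>n. \<integral>\<^sup>+x. ?f n x * indicator B x \<partial>M)"
    if B: "B \<in> sets M" "B \<subseteq> W w" for w B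
  proof -
    obtain a b n where w: "from_nat w = (a :: rat, b :: rat, n :: nat)" by (metis prod_cases3)
    show ?thesis
    proof (cases "0 < a \<and> 0 < b")
      case True
      define a' b' where "a' = real_of_rat a" and "b' = real_of_rat b"
      have ab: "0 < a'" "0 < b'" using True by (auto simp: a'_def b'_def)
      have Fw: "F w = ennreal (\<kappa> * ((a' / 2) powr (N + p) / b' powr N))"
        using True by (simp add: F_def w a'_def b'_def)
      define r0 where "r0 = 1 / real (Suc n)"
      have r0: "0 < r0" by (simp add: r0_def)
      have H1: "\<bar>u x - u y\<bar> \<le> b' * dist x y" if "x \<in> B" "dist x y < r0" for x y
        using that B(2) by (auto simp: W_def w S2_def r0_def b'_def)
      \<comment> \<open>A rational radius between R/2 and R recovers all real radii, with a'
        weakened to a'/2.\<close>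
      have H2: "\<exists>y\<in>ball x R. (a' / 2) * R \<le> \<bar>u y - u x\<bar>" if "x \<in> B" "0 < R" "R < r0" for x R
      proof -
        obtain q where q: "R / 2 < real_of_rat q" "real_of_rat q < R"
          using of_rat_dense[of "R / 2" R] \<open>0 < R\<close> by auto
        have "0 < real_of_rat q" using q \<open>0 < R\<close> by linarith
        then have q0: "0 < q" by (simp only: zero_less_of_rat_iff)
        have "real_of_rat q < real_of_rat (1 / of_nat (Suc n))"
          using q that(3) by (simp add: r0_def of_rat_divide of_rat_add)
        then have "q < 1 / of_nat (Suc n)" by (simp only: of_rat_less)
        moreover have "x \<in> S1 a' n" using that(1) B(2) by (auto simp: W_def w a'_def)
        ultimately obtain y where y: "y \<in> ball x (real_of_rat q)" "a' * real_of_rat q < \<bar>u y - u x\<bar>"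
          using q0 unfolding S1_def by blast
        have "(a' / 2) * R \<le> a' * real_of_rat q" using q ab by simp
        then show ?thesis using y q by (intro bexI[of _ y]) auto
      qed
      have comp: "F w * emeasure M K \<le> liminf (\<lambda>n. \<integral>\<^sup>+x. ?f n x * indicator B x \<partial>M)"
        if K: "compact K" "K \<subseteq> B" for K
      proof (cases "K = {}")
        case False
        then obtain x where x: "x \<in> B" using K by auto
        \<comment> \<open>Comparing the two slope bounds at a single pair of points shows a'/2 \<le>
          b', which the compact case requires.\<close>
        obtain y where y: "y \<in> ball x (r0 / 2)" "(a' / 2) * (r0 / 2) \<le> \<bar>u y - u x\<bar>"
          using H2[OF x, of "r0 / 2"] r0 by auto
        have "\<bar>u x - u y\<bar> \<le> b' * dist x y" using y r0 by (intro H1 x) auto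
        also have "\<dots> \<le> b' * (r0 / 2)" using y ab by (intro mult_left_mono) auto
        finally have "(a' / 2) * (r0 / 2) \<le> b' * (r0 / 2)" using y(2) by (simp add: abs_minus_commute)
        then have ab': "a' / 2 \<le> b'" using r0 by (subst (asm) mult_le_cancel_right_pos) simp_all
        have "F w * emeasure M K \<le> liminf (\<lambda>n. \<integral>\<^sup>+x. ?f n x * indicator K x \<partial>M)"
          unfolding Fw \<kappa>_def
          using K ab ab' r0 assms(2,3)
          by (intro liminf_slice_ge_compact[OF cont _ _ _ _ _ _ _ _ growth dens X] H1 H2) auto
        also have "\<dots> \<le> liminf (\<lambda>n. \<integral>\<^sup>+x. ?f n x * indicator B x \<partial>M)"
          using K(2) by (intro Liminf_mono always_eventually allI nn_integral_mono mult_left_mono) (auto simp: indicator_def)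
        finally show ?thesis .
      qed simp
      have "F w * emeasure M B = (SUP K\<in>{K. compact K \<and> K \<subseteq> B}. F w * emeasure M K)"
        using emeasure_eq_SUP_compact[of B] B(1) by (simp add: SUP_mult_left_ennreal)
      also have "\<dots> \<le> liminf (\<lambda>n. \<integral>\<^sup>+x. ?f n x * indicator B x \<partial>M)"
        by (rule SUP_least) (use comp in auto)
      finally show ?thesis .
    qed (auto simp: F_def w)
  qed
  have "ennreal (\<kappa> / (4 powr (N + p) * 2 powr N)) * lip_energy M N p u \<le> (\<integral>\<^sup>+x. (SUP w. F w * indicator (W w) x) \<partial>M)"
    unfolding lip_energy_def
  proof (rule nn_integral_cmult_le)
    fix x
    let ?l = "enn2real (lip_slope u x)" and ?L = "enn2real (Lip_slope u x)"
    show "ennreal (\<kappa> / (4 powr (N + p) * 2 powr N)) * ennreal (?l powr (N + p) / ?L powr N) \<le> (SUP w. F w * indicator (W w) x)"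
    proof (cases "?l = 0")
      case True
      then show ?thesis by simp
    next
      case False
      then have l0: "0 < ?l" using enn2real_nonneg[of "lip_slope u x"] by linarith
      have fin: "Lip_slope u x < top"
        using Lip_slope_le_lipschitz[OF L, of x] by (rule le_less_trans) simp
      then have fin': "lip_slope u x < top" using lip_slope_le_Lip_slope by (rule le_less_trans[rotated])
      have "?l \<le> ?L" using fin lip_slope_le_Lip_slope by (intro enn2real_mono) auto
      then have L0: "0 < ?L" using l0 by linarith
      \<comment> \<open>Within a factor 2 of the slopes and strictly on the side on which the limits
        yield uniform bounds at small scales.\<close>
      obtain a where a: "?l / 2 < real_of_rat a" "real_of_rat a < ?l"
        using of_rat_dense[of "?l / 2" ?l] l0 by auto
      obtain b where b: "?L < real_of_rat b" "real_of_rat b < 2 * ?L"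
        using of_rat_dense[of ?L "2 * ?L"] L0 by auto
      define a' b' where "a' = real_of_rat a" and "b' = real_of_rat b"
      have ab: "?l / 2 < a'" "a' < ?l" "?L < b'" "b' < 2 * ?L" using a b by (auto simp: a'_def b'_def)
      then have ab0: "0 < a'" "0 < b'" using l0 L0 by linarith+
      have "ennreal a' < lip_slope u x"
        using ab fin' ab0 by (metis ennreal_enn2real ennreal_lessI l0)
      then obtain d1 where d1: "0 < d1" "\<And>r. 0 < r \<Longrightarrow> r < d1 \<Longrightarrow> \<exists>y\<in>ball x r. a' * r < \<bar>u y - u x\<bar>"
        using less_lip_slopeD[of a' u x] ab0 by (meson less_imp_le)
      have "Lip_slope u x < ennreal b'"
        using ab fin ab0 by (metis ennreal_enn2real ennreal_lessI)
      then obtain d2 where d2: "0 < d2" "\<And>y. dist x y < d2 \<Longrightarrow> \<bar>u x - u y\<bar> \<le> b' * dist x y"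
        using Lip_slope_lessD[of u x b'] ab0 by blast
      obtain n where n: "1 / real (Suc n) < min d1 d2"
        using nat_approx_posE[of "min d1 d2"] d1(1) d2(1) by auto
      define w where "w = to_nat (a, b, n)"
      have w: "from_nat w = (a, b, n)" by (simp add: w_def)
      have "x \<in> S1 a' n"
        unfolding S1_def
      proof (intro CollectI allI impI)
        fix q :: rat assume q: "0 < q" "q < 1 / of_nat (Suc n)"
        have "real_of_rat q < real_of_rat (1 / of_nat (Suc n))" using q(2) by (simp only: of_rat_less)
        also have "\<dots> = 1 / real (Suc n)" by (simp add: of_rat_divide of_rat_add)
        finally have "real_of_rat q < d1" using n by simp
        then show "\<exists>y\<in>ball x (real_of_rat q). a' * real_of_rat q < \<bar>u y - u x\<bar>"
          using q(1) by (intro d1) auto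
      qed
      moreover have "x \<in> S2 b' n"
        unfolding S2_def using n d2(2) by auto
      ultimately have "x \<in> W w" by (simp add: W_def w a'_def b'_def)
      have "\<kappa> / (4 powr (N + p) * 2 powr N) * (?l powr (N + p) / ?L powr N) \<le> \<kappa> * ((a' / 2) powr (N + p) / b' powr N)"
      proof -
        have "(?l / 4) powr (N + p) / (2 * ?L) powr N \<le> (a' / 2) powr (N + p) / b' powr N"
        proof (rule frac_le)
          show "(?l / 4) powr (N + p) \<le> (a' / 2) powr (N + p)"
            by (rule powr_mono2) (use ab N_pos p_pos in auto)
          show "b' powr N \<le> (2 * ?L) powr N"
            by (rule powr_mono2) (use ab ab0 N_pos in auto)
        qed (use ab0 in auto)
        from mult_left_mono[OF this, of \<kappa>] \<kappa> show ?thesis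
          using l0 L0 by (simp add: powr_divide powr_mult field_simps)
      qed
      then have "ennreal (\<kappa> / (4 powr (N + p) * 2 powr N)) * ennreal (?l powr (N + p) / ?L powr N) \<le> F w"
        using ab0 \<kappa> by (simp add: F_def w a'_def b'_def ennreal_mult'[symmetric] ennreal_leI)
      also have "\<dots> = F w * indicator (W w) x" using \<open>x \<in> W w\<close> by simp
      also have "\<dots> \<le> (SUP w. F w * indicator (W w) x)" by (rule SUP_upper) simp
      finally show ?thesis .
    qed
  next
    show "(\<lambda>x. SUP w. F w * indicator (W w) x) \<in> borel_measurable M"
      using W_sets by (intro borel_measurable_SUP borel_measurable_times_ennreal borel_measurable_const borel_measurable_indicator) auto
    show "0 < \<kappa> / (4 powr (N + p) * 2 powr N)" using \<kappa> by simp
  qed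
  also have "\<dots> \<le> liminf (\<lambda>n. \<integral>\<^sup>+x. ?f n x \<partial>M)"
    by (rule nn_integral_SUP_indicator_le_liminf[OF f W_sets le])
  also have "\<dots> = liminf (\<lambda>n. Q u (X n))"
    by (simp add: Q_eq_integral[OF X(1) cont])
  finally show ?thesis by (simp add: \<kappa>_def)
qed

end

section \<open>The optimal doubling constant and the equivalence\<close>

lemma emeasure_ball_mms:
  assumes "metric_measure_space M" "0 < r"
  shows "emeasure M (ball x r) = ennreal (measure M (ball x r))" "0 < measure M (ball x r)"
proof -
  have "0 < emeasure M (ball x r)" "emeasure M (ball x r) < \<infinity>"
    using assms by (auto simp: metric_measure_space_def)
  moreover from this(2) show "emeasure M (ball x r) = ennreal (measure M (ball x r))"
    by (intro emeasure_eq_ennreal_measure) simp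
  ultimately show "0 < measure M (ball x r)" by simp
qed

lemma optimal_doubling_constantD:
  assumes "metric_measure_space M" "optimal_doubling_constant M = ennreal \<beta>" "0 \<le> \<beta>" "0 < r"
  shows "measure M (ball x (2 * r)) \<le> \<beta> * measure M (ball x r)"
proof -
  have r2: "0 < 2 * r" using assms by simp
  have "emeasure M (ball x (2 * r)) / emeasure M (ball x r) \<le> optimal_doubling_constant M"
    unfolding optimal_doubling_constant_def
    by (rule SUP_upper2[of x], simp, rule SUP_upper) (use assms in simp)
  then have "ennreal (measure M (ball x (2 * r)) / measure M (ball x r)) \<le> ennreal \<beta>"
    using emeasure_ball_mms[OF assms(1,4), of x] emeasure_ball_mms[OF assms(1) r2, of x]
    by (simp add: assms(2) divide_ennreal)
  then show ?thesis
    using emeasure_ball_mms(2)[OF assms(1,4), of x] assms(3) by (simp add: ennreal_le_iff field_simps)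
qed

text \<open>In a one-point space all balls of positive radius coincide and the optimal constant is
  1. The second point provides the geodesics for the volume growth estimate.\<close>

lemma optimal_doubling_constant_gt_1_imp_two_points:
  fixes M :: "'a::polish_space measure"
  assumes "metric_measure_space M" "optimal_doubling_constant M = ennreal \<beta>" "1 < \<beta>"
  shows "\<exists>x y :: 'a. x \<noteq> y"
proof (rule ccontr)
  assume "\<not> ?thesis"
  then have one: "x = y" for x y :: 'a by blast
  have "emeasure M (ball x (2 * r)) / emeasure M (ball x r) \<le> 1" if "0 < r" for x :: 'a and r
  proof -
    have "y \<in> ball x s" if "0 < s" for y s using one[of x y] that by simp
    then have "ball x (2 * r) = ball x r" using \<open>0 < r\<close> by (intro set_eqI) simp
    then show ?thesis
      using emeasure_ball_mms[OF assms(1) that, of x] by (simp add: divide_ennreal)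
  qed
  then have "optimal_doubling_constant M \<le> 1"
    unfolding optimal_doubling_constant_def by (intro SUP_least) simp
  then show False using assms(2,3) by simp
qed

theorem theorem1p6:
  fixes M :: "'a::polish_space measure" and p \<beta> N :: real
  assumes "p \<ge> 1"
    and "metric_measure_space M"
    and "geodesic_space TYPE('a)"
    and "doubling_measure M"
    and "optimal_doubling_constant M = ennreal \<beta>" and "1 < \<beta>"
    and "N = ln \<beta> / ln 2"
  shows
    "(\<exists>C1 C2 :: real. C1 > 0 \<and> C2 > 0 \<and>
        (\<forall>u\<in>Lip_b.
           ennreal C1 * lip_energy M N p u
             \<le> Liminf at_top (\<lambda>l::real. ennreal (l powr p) * emeasure (M \<Otimes>\<^sub>M M) (E_set N p l u)) \<and>
           Liminf at_top (\<lambda>l::real. ennreal (l powr p) * emeasure (M \<Otimes>\<^sub>M M) (E_set N p l u))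
             \<le> Limsup at_top (\<lambda>l::real. ennreal (l powr p) * emeasure (M \<Otimes>\<^sub>M M) (E_set N p l u)) \<and>
           Limsup at_top (\<lambda>l::real. ennreal (l powr p) * emeasure (M \<Otimes>\<^sub>M M) (E_set N p l u))
             \<le> ennreal C2 * Lip_energy M p u))
     \<longleftrightarrow>
     (\<exists>a1 a2 :: real. a1 > 0 \<and> a2 > 0 \<and>
        (AE x in M. ennreal a1 \<le> lower_density M N x \<and>
                    lower_density M N x \<le> upper_density M N x \<and>
                    upper_density M N x \<le> ennreal a2))"
proof -
  interpret doubling_mms M \<beta> N p
    using assms optimal_doubling_constantD[OF assms(2,5)] by unfold_locales auto
  have \<beta>0: "0 < \<beta>" using assms(6) by simp
  have cont: "continuous_on UNIV u" if "u \<in> Lip_b" for u :: "'a \<Rightarrow> real"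
    using that lipschitz_on_continuous_on by (auto simp: Lip_b_def)
  show ?thesis (is "?a \<longleftrightarrow> ?b")
  proof
    assume ?a
    then obtain C1 C2 where C: "0 < C1" "0 < C2"
      and a1: "\<And>u. u \<in> Lip_b \<Longrightarrow> ennreal C1 * lip_energy M N p u \<le> Liminf (at_right 0) (Q u)"
      and a2: "\<And>u. u \<in> Lip_b \<Longrightarrow> Limsup (at_right 0) (Q u) \<le> ennreal C2 * Lip_energy M p u"
      by (auto simp: Liminf_Q Limsup_Q cont)
    obtain A where A: "0 < A" "\<And>x R. 0 < R \<Longrightarrow> V x R \<le> A * R powr N"
      using ball_growth[OF assms(3) optimal_doubling_constant_gt_1_imp_two_points[OF assms(2,5,6)] C(2) a2] by blast
    \<comment> \<open>Half of the largest value allowed by the strict threshold for null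
      sets.\<close>
    define c where "c = C1 * (1/2) powr (N + p) / (2 * \<beta>)"
    have c: "0 < c" "\<beta> * c < C1 * (1/2) powr (N + p)"
      using C \<beta>0 by (auto simp: c_def)
    let ?Z = "{x. \<forall>R>0. V x R \<le> c * R powr N}"
    have "emeasure M ?Z = 0" by (rule small_growth_null[OF assms(3) C(1) A a1 c])
    then have "?Z \<in> null_sets M"
      using borel_closed[OF closed_small_growth[of c]] by (intro null_setsI) simp_all
    then have "AE x in M. x \<notin> ?Z" by (rule AE_not_in)
    then have "AE x in M. ennreal (c / \<beta>) \<le> lower_density M N x \<and>
        lower_density M N x \<le> upper_density M N x \<and> upper_density M N x \<le> ennreal A"
    proof eventually_elim
      case (elim x)
      \<comment> \<open>Leaving the null set means large volume at one scale only; that scale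
        determines the lower density bound.\<close>
      then obtain R where "0 < R" "\<beta> * (c / \<beta>) * R powr N < V x R"
        using \<beta>0 by (auto simp: not_le)
      then have "ennreal (c / \<beta>) \<le> lower_density M N x" by (rule lower_density_ge)
      moreover have "lower_density M N x \<le> upper_density M N x"
        unfolding lower_density_def upper_density_def by (rule Liminf_le_Limsup) simp
      moreover have "upper_density M N x \<le> ennreal A" by (rule upper_density_of_growth) (rule A)
      ultimately show ?case by blast
    qed
    moreover have "0 < c / \<beta>" using c \<beta>0 by simp
    ultimately show ?b using A(1) by blast
  next
    assume ?b
    then obtain a1 a2 where a: "0 < a1" "0 < a2"
      and d: "AE x in M. ennreal a1 \<le> lower_density M N x \<and>
        lower_density M N x \<le> upper_density M N x \<and> upper_density M N x \<le> ennreal a2"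
      by blast
    have growth: "AE x in M. \<forall>R>0. V x R \<le> \<beta> * a2 * R powr N"
      using d
    proof eventually_elim
      case (elim x)
      then show ?case using growth_of_upper_density[of x a2] a by auto
    qed
    have dens: "AE x in M. \<forall>\<^sub>F r in at_right 0. a1 / 2 * r powr N \<le> V x r"
      using d
    proof eventually_elim
      case (elim x)
      then show ?case using lower_densityD[of a1 x] a by auto
    qed
    have A: "0 < \<beta> * a2" "0 < a1 / 2" using a \<beta>0 by auto
    define C1 where "C1 = a1 / 2 / (6 powr N * 4 powr p * \<beta> ^ 3) / (4 powr (N + p) * 2 powr N)"
    have C1: "0 < C1" using a \<beta>0 by (simp add: C1_def)
    have C2: "0 < \<beta> * a2 * \<beta>" using A \<beta>0 by simp
    have "ennreal C1 * lip_energy M N p u \<le> Liminf (at_right 0) (Q u)" if "u \<in> Lip_b" for u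
      unfolding C1_def
      by (rule Liminf_at_right_0_sequentially_ge) (rule liminf_slice_ge[OF that A growth dens])
    moreover have "Limsup (at_right 0) (Q u) \<le> ennreal (\<beta> * a2 * \<beta>) * Lip_energy M p u" if "u \<in> Lip_b" for u
      by (rule Limsup_Q_le[OF that A(1) growth])
    moreover have "Liminf (at_right 0) (Q u) \<le> Limsup (at_right 0) (Q u)" for u
      by (rule Liminf_le_Limsup) simp
    ultimately show ?a using C1 C2 by (auto simp: Liminf_Q Limsup_Q cont)
  qed
qed

end
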